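(* Let $K>1$ and let $\mathcal{L}=\{L_m,m\in\mathcal{M}\}$ be a collection of nonnegative weights such that $$\Sigma'=\sum_{m\in\mathcal{M}}(D_m+1)e^{-L_m}<+\infty.$$ If $\mathrm{pen}=\mathrm{pen}_{K,\mathcal{L}}$, then with probability 1 there exists an index $\hat m\in\mathcal{M}$ which minimizes over $m\in\mathcal{M}$ $$\mathrm{Crit}_L(m)=\|Y-\Pi_mY\|^2\left(1+\frac{\mathrm{pen}(m)}{N_m}\right).$$ Besides, the estimator $\hat\mu_{\hat m}$ satisfies $$\mathbb{E}\left[\frac{\|\mu-\hat\mu_{\hat m}\|^2}{\sigma^2}\right]\le\frac{K}{K-1}\inf_{m\in\mathcal{M}}\left[\frac{\|\mu-\mu_m\|^2}{\sigma^2}\left(1+\frac{\mathrm{pen}(m)}{N_m}\right)+\mathrm{pen}(m)-D_m\right]+\Sigma$$ with $$\Sigma=\frac{2K^2}{K-1}\sum_{m\in\mathcal{M}}(D_m+1)\,\mathsf{Dkhi}\left[D_m+1,\,N_m-1,\,\frac{N_m-1}{KN_m}\mathrm{pen}(m)\right]\le\frac{2K^2\Sigma'}{K-1}.$$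
   Context: Model: $Y=(Y_1,\dots,Y_n)'$ with $Y_i=\mu_i+\sigma\varepsilon_i$, where $\mu\in\mathbb{R}^n$ and $\sigma>0$ are unknown and the $\varepsilon_i$ are i.i.d. standard Gaussian. $\|\cdot\|$ is the Euclidean norm on $\mathbb{R}^n$. $\{S_m,m\in\mathcal{M}\}$ is a collection of linear subspaces of $\mathbb{R}^n$ indexed by a finite or countable set $\mathcal{M}$; $\Pi_m$ is the orthogonal projector onto $S_m$, $D_m=\dim S_m$, $N_m=n-D_m$, $\mu_m=\Pi_m\mu$, $\hat\mu_m=\Pi_mY$. It is assumed that $D_m\le n-2$ for all $m\in\mathcal{M}$. For positive integers $D,N$ and $x\ge0$, with $X_D,X_N$ independent $\chi^2$ random variables with $D$ and $N$ degrees of freedom, $\mathsf{Dkhi}[D,N,x]=\frac{1}{\mathbb{E}(X_D)}\mathbb{E}\left[\left(X_D-x\frac{X_N}{N}\right)_+\right]$; for fixed $D,N$ it is decreasing in $x$ from $[0,\infty)$ into $(0,1]$ with value $1$ at $x=0$. For $0<q\le1$, $\mathsf{EDkhi}[D,N,q]$ is the unique solution $x\geq 0$ of $\mathsf{Dkhi}[D,N,x]=q$. The penalty is $$\mathrm{pen}_{K,\mathcal{L}}(m)=K\frac{N_m}{N_m-1}\mathsf{EDkhi}[D_m+1,N_m-1,e^{-L_m}],\qquad m\in\mathcal{M}.$$ *)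

theory Defs
  imports "HOL-Probability.Probability"
begin

text \<open>Orthogonal projector onto a linear subspace of a Euclidean space; the description is
  well defined by \<open>orth_proj_ex1\<close> below.\<close>

definition orth_proj :: "'a::euclidean_space set \<Rightarrow> 'a \<Rightarrow> 'a" where
  "orth_proj S x = (THE p. p \<in> S \<and> (\<forall>v\<in>S. orthogonal (x - p) v))"

lemma orth_proj_ex1:
  fixes S :: "'a::euclidean_space set"
  assumes "subspace S"
  shows "\<exists>!p. p \<in> S \<and> (\<forall>v\<in>S. orthogonal (x - p) v)"
proof -
  obtain p z where pz: "p \<in> span S" "\<And>w. w \<in> span S \<Longrightarrow> orthogonal z w" "x = p + z"
    using orthogonal_subspace_decomp_exists by blast
  have sp: "span S = S"
    using assms by (simp add: span_eq_iff)
  show ?thesis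
  proof (rule ex1I)
    show "p \<in> S \<and> (\<forall>v\<in>S. orthogonal (x - p) v)"
      using pz sp by auto
  next
    fix q assume q: "q \<in> S \<and> (\<forall>v\<in>S. orthogonal (x - q) v)"
    have "q - p \<in> S"
      using q pz(1) sp assms by (simp add: subspace_diff)
    then have "orthogonal (x - q) (q - p)" "orthogonal (x - p) (q - p)"
      using q pz sp by auto
    then have "(q - p) \<bullet> (q - p) = 0"
      unfolding orthogonal_def by (simp add: inner_diff_left inner_diff_right)
    then show "q = p" by simp
  qed
qed

definition chi_square :: "nat \<Rightarrow> real measure" where
  "chi_square k =
     distr (\<Pi>\<^sub>M i\<in>{..<k}. density lborel std_normal_density) borel (\<lambda>x. \<Sum>i<k. (x i)\<^sup>2)"

text \<open>Independence of the two \<open>\<chi>\<^sup>2\<close> variables is encoded by integrating against the product of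
  their laws.\<close>

definition Dkhi :: "nat \<Rightarrow> nat \<Rightarrow> real \<Rightarrow> real" where
  "Dkhi D N x =
     (1 / (LINT u|chi_square D. u)) *
     (LINT (u, v)|(chi_square D \<Otimes>\<^sub>M chi_square N). max (u - x * (v / real N)) 0)"

text \<open>Only meaningful for positive \<open>D\<close>, \<open>N\<close> and for \<open>q\<close> in the interval from 0 (excluded) to
  1 (included).\<close>

definition EDkhi :: "nat \<Rightarrow> nat \<Rightarrow> real \<Rightarrow> real" where
  "EDkhi D N q = (THE x. 0 \<le> x \<and> Dkhi D N x = q)"

definition codim :: "(real ^ 'n) set \<Rightarrow> nat" where
  "codim S = CARD('n) - dim S"

definition pen_KL :: "real \<Rightarrow> ('m \<Rightarrow> real) \<Rightarrow> ('m \<Rightarrow> (real ^ 'n) set) \<Rightarrow> 'm \<Rightarrow> real" where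
  "pen_KL K L S m =
     K * (real (codim (S m)) / real (codim (S m) - 1)) *
     EDkhi (dim (S m) + 1) (codim (S m) - 1) (exp (- L m))"

definition Crit ::
    "('m \<Rightarrow> (real ^ 'n) set) \<Rightarrow> ('m \<Rightarrow> real) \<Rightarrow> real ^ 'n \<Rightarrow> 'm \<Rightarrow> real" where
  "Crit S pen y m =
     (norm (y - orth_proj (S m) y))\<^sup>2 * (1 + pen m / real (codim (S m)))"

definition minimizes_over :: "'m set \<Rightarrow> ('m \<Rightarrow> real) \<Rightarrow> 'm \<Rightarrow> bool" where
  "minimizes_over A f m \<longleftrightarrow> m \<in> A \<and> (\<forall>m'\<in>A. f m \<le> f m')"

definition Sigma_term ::
    "real \<Rightarrow> ('m \<Rightarrow> (real ^ 'n) set) \<Rightarrow> ('m \<Rightarrow> real) \<Rightarrow> 'm \<Rightarrow> real" where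
  "Sigma_term K S pen m =
     real (dim (S m) + 1) *
     Dkhi (dim (S m) + 1) (codim (S m) - 1)
       (real (codim (S m) - 1) / (K * real (codim (S m))) * pen m)"

end

theory Submission
  imports Defs
begin

text \<open>
  Write \<open>U m\<close> for the squared length of the projection of the noise \<open>\<epsilon>\<close> onto the span of \<open>S m\<close> and of
  one unit vector \<open>u\<close> that is orthogonal to \<open>S m\<close> and parallel to the bias
  \<open>\<mu> - orth_proj (S m) \<mu>\<close>, and \<open>V m\<close> for the squared length of the projection onto the orthogonal
  complement of that span. By rotation invariance of the Gaussian law, \<open>U m\<close> and \<open>V m\<close> are
  independent \<open>\<chi>\<^sup>2\<close> variables with \<open>dim (S m) + 1\<close> and \<open>codim (S m) - 1\<close> degrees of freedom
  (lemma \<open>model_statistics\<close>). The direction \<open>u\<close> is where the bias enters: on the complement of the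
  span the observation is pure noise, so that \<open>\<sigma>\<^sup>2 * V m\<close> bounds the residual sum of squares from
  below whatever \<open>\<mu>\<close> is.

  Risk bound. Expanding squares and absorbing the cross term \<open>2 * (bias \<bullet> \<epsilon>)\<close> by the
  arithmetic-geometric inequality with weight \<open>K\<close> bounds \<open>(K - 1) / K\<close> times the loss of any model by
  its residual sum of squares, minus \<open>(norm \<epsilon>)\<^sup>2\<close>, plus \<open>K * U m\<close> (lemma \<open>pathwise_risk_bound\<close>, in
  units of \<open>\<sigma>\<^sup>2\<close>). For the selected model the penalty part of the criterion dominates
  \<open>K * x m * V m / (codim (S m) - 1)\<close>, where \<open>x m\<close> is the value of \<open>EDkhi\<close> that enters the penalty. So
  the loss is controlled by the criterion of any competitor plus \<open>K\<close> times the positive part of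
  \<open>U m - x m * V m / (codim (S m) - 1)\<close> at the selected \<open>m\<close>. The latter is at most the sum of these
  positive parts over all models, whose expectations are by definition of \<open>Dkhi\<close> the terms of \<open>\<Sigma>\<close>.
  Taking expectations gives the bound, with a factor 2 to spare in \<open>\<Sigma>\<close>.

  Comparison of \<open>\<Sigma>\<close> and \<open>\<Sigma>'\<close>. The argument of \<open>Dkhi\<close> in \<open>\<Sigma>\<close> is exactly \<open>x m\<close>, hence its value is
  \<open>exp (- L m)\<close> and the two series agree term by term. This needs that \<open>Dkhi\<close> takes each value in the
  interval from 0 (excluded) to 1 exactly once (lemma \<open>EDkhi_inverse\<close>): it is convex, starts at 1 and
  tends to 0, and a convex function with limit 0 at infinity takes no positive value twice.

  Existence of a minimizer. The criterion tends to infinity along the models, almost surely. It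
  dominates a multiple of \<open>x m * V m / (codim (S m) - 1)\<close>, and if that quantity is at most \<open>c\<close> while
  independently \<open>U m \<ge> 2 * c\<close>, then the positive part above is at least \<open>c\<close>. Since \<open>U m \<ge> 2 * c\<close> has
  probability bounded away from 0 uniformly in \<open>m\<close>, the probabilities of small values are summable
  and the Borel-Cantelli argument applies.
\<close>

section \<open>Orthogonal invariance of Lebesgue measure\<close>

text \<open>
  The image measure \<open>\<nu>\<close> is again translation invariant, and such a measure is a multiple of Lebesgue
  measure by Fubini: evaluating the integral of \<open>indicator B y * indicator A (y + x)\<close> in both orders
  gives \<open>\<nu> A * lborel B = \<nu> B * lborel A\<close> for symmetric \<open>B\<close>. The unit ball \<open>B\<close> is mapped to itself,
  so the factor is 1.
\<close>

lemma lborel_distr_orthogonal_transformation: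
  fixes T :: "'a::euclidean_space \<Rightarrow> 'a"
  assumes T: "orthogonal_transformation T"
  shows "distr lborel borel T = lborel"
proof (rule measure_eqI)
  have linT: "linear T" using T by (rule orthogonal_transformation_linear)
  have [measurable]: "T \<in> borel_measurable borel"
    using linT by (intro borel_measurable_continuous_onI linear_continuous_on) (simp add: linear_conv_bounded_linear)
  define \<nu> where "\<nu> = distr lborel borel T"
  define B :: "'a set" where "B = ball 0 1"
  have [measurable, simp]: "B \<in> sets borel" by (simp add: B_def)
  have sets_nu[measurable_cong, simp]: "sets \<nu> = sets borel" and space_nu[simp]: "space \<nu> = UNIV"
    by (auto simp: \<nu>_def)
  have TB: "T -` B = B"
    by (auto simp: B_def orthogonal_transformation_norm[OF T])
  have nuB: "emeasure \<nu> B = emeasure lborel B"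
    unfolding \<nu>_def by (subst emeasure_distr) (auto simp: TB)
  have B_pos: "emeasure lborel B \<noteq> 0"
    using unit_ball_vol_pos[of "real DIM('a)", THEN less_imp_neq] by (simp add: B_def emeasure_ball)
  have B_fin: "emeasure lborel B \<noteq> \<infinity>"
    unfolding B_def using emeasure_bounded_finite[of "ball (0::'a) 1"] by simp
  have transl: "distr \<nu> borel ((+) c) = \<nu>" for c
  proof -
    obtain d where d: "T d = c"
      using orthogonal_transformation_surj[OF T] by (metis surjD)
    have "distr \<nu> borel ((+) c) = distr lborel borel ((+) c \<circ> T)"
      unfolding \<nu>_def by (subst distr_distr) auto
    also have "(+) c \<circ> T = T \<circ> (+) d"
      using d linT by (auto simp: linear_add)
    also have "distr lborel borel (T \<circ> (+) d) = distr (distr lborel borel ((+) d)) borel T"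
      by (subst distr_distr) auto
    finally show ?thesis by (simp add: lborel_distr_plus \<nu>_def)
  qed
  have trans_int: "(\<integral>\<^sup>+x. f (c + x) \<partial>\<nu>) = (\<integral>\<^sup>+x. f x \<partial>\<nu>)"
    if [measurable]: "f \<in> borel_measurable borel" for f and c
    by (subst (2) transl[of c, symmetric], subst nn_integral_distr) auto
  have trans_lborel: "(\<integral>\<^sup>+x. f (c + x) \<partial>lborel) = (\<integral>\<^sup>+x. f x \<partial>lborel)"
    if [measurable]: "f \<in> borel_measurable borel" for f and c :: 'a
    by (subst (2) lborel_distr_plus[of c, symmetric], subst nn_integral_distr) auto
  interpret nu: sigma_finite_measure \<nu>
  proof
    have "T -` ball 0 (real n) = ball 0 (real n)" for n
      by (auto simp: orthogonal_transformation_norm[OF T])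
    then have "emeasure \<nu> (ball 0 (real n)) \<noteq> \<infinity>" for n
      unfolding \<nu>_def using emeasure_bounded_finite[of "ball (0::'a) (real n)"]
      by (subst emeasure_distr) auto
    moreover have "(\<Union>n::nat. ball 0 (real n)) = (UNIV :: 'a set)"
      by (auto intro: reals_Archimedean2)
    ultimately show "\<exists>A. countable A \<and> A \<subseteq> sets \<nu> \<and> \<Union> A = space \<nu> \<and> (\<forall>a\<in>A. emeasure \<nu> a \<noteq> \<infinity>)"
      by (intro exI[of _ "range (\<lambda>n::nat. ball 0 (real n))"]) auto
  qed
  interpret nl: pair_sigma_finite \<nu> "lborel :: 'a measure" ..
  fix A assume "A \<in> sets (distr lborel borel T)"
  then have [measurable]: "A \<in> sets borel" by simp
  have sym: "indicator B (y - x) \<equiv> (indicator B (- y + x) :: ennreal)" for x y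
    by (rule eq_reflection) (auto simp: B_def indicator_def dist_norm norm_minus_commute)
  have "emeasure \<nu> A * emeasure lborel B =
      (\<integral>\<^sup>+y. indicator B y * (\<integral>\<^sup>+x. indicator A x \<partial>\<nu>) \<partial>lborel)"
    by (simp add: nn_integral_multc mult.commute)
  also have "\<dots> = (\<integral>\<^sup>+y. indicator B y * (\<integral>\<^sup>+x. indicator A (y + x) \<partial>\<nu>) \<partial>lborel)"
    by (intro nn_integral_cong, subst trans_int) auto
  also have "\<dots> = (\<integral>\<^sup>+y. \<integral>\<^sup>+x. indicator B y * indicator A (y + x) \<partial>\<nu> \<partial>lborel)"
    by (intro nn_integral_cong nn_integral_cmult[symmetric]) auto
  also have "\<dots> = (\<integral>\<^sup>+x. \<integral>\<^sup>+y. indicator B y * indicator A (y + x) \<partial>lborel \<partial>\<nu>)"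
    by (rule nl.Fubini') measurable
  also have "\<dots> = (\<integral>\<^sup>+x. \<integral>\<^sup>+y. indicator B (y - x) * indicator A y \<partial>lborel \<partial>\<nu>)"
    using trans_lborel[of "\<lambda>y. indicator B (y - x) * indicator A y" x for x] by (simp add: add.commute)
  also have "\<dots> = (\<integral>\<^sup>+y. \<integral>\<^sup>+x. indicator B (y - x) * indicator A y \<partial>\<nu> \<partial>lborel)"
    by (rule nl.Fubini'[symmetric]) measurable
  also have "\<dots> = (\<integral>\<^sup>+y. (\<integral>\<^sup>+x. indicator B (y - x) \<partial>\<nu>) * indicator A y \<partial>lborel)"
    by (intro nn_integral_cong nn_integral_multc) auto
  also have "\<dots> = (\<integral>\<^sup>+y. (\<integral>\<^sup>+x. indicator B (- y + x) \<partial>\<nu>) * indicator A y \<partial>lborel)"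
    unfolding sym ..
  also have "\<dots> = emeasure \<nu> B * emeasure lborel A"
    by (subst trans_int) (auto simp: nn_integral_cmult)
  finally have "emeasure lborel B * emeasure \<nu> A = emeasure lborel B * emeasure lborel A"
    by (simp add: nuB mult.commute)
  then show "emeasure (distr lborel borel T) A = emeasure lborel A"
    using B_pos B_fin by (simp add: ennreal_mult_cancel_left \<nu>_def)
qed simp

section \<open>Standard Gaussian coordinates in orthonormal bases\<close>

lemma prob_space_std_normal: "prob_space (density lborel std_normal_density)"
  by (rule prob_space_normal_density) simp

lemma PiM_density_eq:
  fixes f :: "'i \<Rightarrow> 'a \<Rightarrow> ennreal"
  assumes I: "finite I" and M: "\<And>i. sigma_finite_measure (M i)"
    and f[measurable]: "\<And>i. f i \<in> borel_measurable (M i)"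
    and fM: "\<And>i. sigma_finite_measure (density (M i) (f i))"
  shows "(\<Pi>\<^sub>M i\<in>I. density (M i) (f i)) = density (\<Pi>\<^sub>M i\<in>I. M i) (\<lambda>x. \<Prod>i\<in>I. f i (x i))"
proof -
  interpret M: product_sigma_finite M
    using M by (simp add: product_sigma_finite_def)
  interpret D: product_sigma_finite "\<lambda>i. density (M i) (f i)"
    using fM by (simp add: product_sigma_finite_def)
  have sets: "sets (\<Pi>\<^sub>M i\<in>I. M i) = sets (\<Pi>\<^sub>M i\<in>I. density (M i) (f i))"
    by (intro sets_PiM_cong) auto
  have [measurable]: "(\<lambda>x. \<Prod>i\<in>I. f i (x i)) \<in> borel_measurable (\<Pi>\<^sub>M i\<in>I. M i)"
    by measurable
  have "density (\<Pi>\<^sub>M i\<in>I. M i) (\<lambda>x. \<Prod>i\<in>I. f i (x i)) = (\<Pi>\<^sub>M i\<in>I. density (M i) (f i))"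
  proof (rule D.PiM_eqI[OF I])
    show "sets (density (\<Pi>\<^sub>M i\<in>I. M i) (\<lambda>x. \<Prod>i\<in>I. f i (x i))) = sets (\<Pi>\<^sub>M i\<in>I. density (M i) (f i))"
      by (simp add: sets)
    fix A assume "\<And>i. i \<in> I \<Longrightarrow> A i \<in> sets (density (M i) (f i))"
    then have A[measurable]: "\<And>i. i \<in> I \<Longrightarrow> A i \<in> sets (M i)" by simp
    have PA[measurable]: "Pi\<^sub>E I A \<in> sets (\<Pi>\<^sub>M i\<in>I. M i)"
      using I A by (intro sets_PiM_I_finite) auto
    have ind: "(\<Prod>i\<in>I. f i (x i)) * indicator (Pi\<^sub>E I A) x = (\<Prod>i\<in>I. f i (x i) * indicator (A i) (x i))"
      if "x \<in> space (\<Pi>\<^sub>M i\<in>I. M i)" for x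
    proof (cases "x \<in> Pi\<^sub>E I A")
      case True
      then show ?thesis by (auto intro!: prod.cong simp: PiE_iff)
    next
      case False
      with that obtain i where "i \<in> I" "x i \<notin> A i"
        by (auto simp: space_PiM PiE_iff)
      then have "(\<Prod>i\<in>I. f i (x i) * indicator (A i) (x i)) = 0"
        using I by (metis (mono_tags, lifting) prod_zero indicator_simps(2) mult_zero_right)
      then show ?thesis using False by simp
    qed
    have "emeasure (density (\<Pi>\<^sub>M i\<in>I. M i) (\<lambda>x. \<Prod>i\<in>I. f i (x i))) (Pi\<^sub>E I A)
      = (\<integral>\<^sup>+x. (\<Prod>i\<in>I. f i (x i) * indicator (A i) (x i)) \<partial>(\<Pi>\<^sub>M i\<in>I. M i))"
      by (subst emeasure_density) (auto intro!: nn_integral_cong simp: ind)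
    also have "\<dots> = (\<Prod>i\<in>I. \<integral>\<^sup>+x. f i x * indicator (A i) x \<partial>M i)"
      using I by (intro M.product_nn_integral_prod) auto
    also have "\<dots> = (\<Prod>i\<in>I. emeasure (density (M i) (f i)) (A i))"
      by (intro prod.cong) (auto simp: emeasure_density)
    finally show "emeasure (density (\<Pi>\<^sub>M i\<in>I. M i) (\<lambda>x. \<Prod>i\<in>I. f i (x i))) (Pi\<^sub>E I A) =
      (\<Prod>i\<in>I. emeasure (density (M i) (f i)) (A i))" .
  qed
  then show ?thesis by simp
qed

text \<open>
  Stated for families indexed by a set, so that the coordinates of one random vector in different
  orthonormal bases, indexed by the basis vectors themselves, are all instances.
\<close>

definition iid_std_normal :: "'w measure \<Rightarrow> ('i \<Rightarrow> 'w \<Rightarrow> real) \<Rightarrow> 'i set \<Rightarrow> bool" where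
  "iid_std_normal P Z I \<longleftrightarrow>
     prob_space.indep_vars P (\<lambda>_. borel) Z I \<and>
     (\<forall>i\<in>I. distributed P lborel (Z i) std_normal_density)"

lemma distributed_distr_borel:
  "distributed P lborel X f \<Longrightarrow> distr P borel X = density lborel f"
  using distributed_distr_eq_density[of P lborel X f] distr_cong[of P P borel lborel X X] by simp

text \<open>
  The joint law determines the property. This is what makes rotation invariance transferable: it is
  proved for laws and read back as a statement on coordinates.
\<close>

lemma (in prob_space) iid_std_normal_iff_distr_PiM:
  fixes Z :: "'i \<Rightarrow> 'a \<Rightarrow> real"
  assumes "finite I" "I \<noteq> {}" and [measurable]: "\<And>i. i \<in> I \<Longrightarrow> Z i \<in> borel_measurable M"
  shows "iid_std_normal M Z I \<longleftrightarrow>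
    distr M (\<Pi>\<^sub>M i\<in>I. borel) (\<lambda>\<omega>. \<lambda>i\<in>I. Z i \<omega>) = (\<Pi>\<^sub>M i\<in>I. density lborel std_normal_density)"
    (is "?L \<longleftrightarrow> ?J = _")
proof
  assume ?L
  then have L: "indep_vars (\<lambda>_. borel) Z I" "\<And>i. i \<in> I \<Longrightarrow> distributed M lborel (Z i) std_normal_density"
    by (auto simp: iid_std_normal_def)
  have "?J = (\<Pi>\<^sub>M i\<in>I. distr M borel (Z i))"
    using indep_vars_iff_distr_eq_PiM'[of I Z "\<lambda>_. borel"] assms L by auto
  also have "\<dots> = (\<Pi>\<^sub>M i\<in>I. density lborel std_normal_density)"
    using L by (intro PiM_cong) (auto simp: distributed_distr_borel)
  finally show "?J = (\<Pi>\<^sub>M i\<in>I. density lborel std_normal_density)" .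
next
  assume R: "?J = (\<Pi>\<^sub>M i\<in>I. density lborel std_normal_density)"
  have marg: "distr M borel (Z i) = density lborel std_normal_density" if i: "i \<in> I" for i
  proof -
    have "distr M borel (Z i) = distr ?J borel (\<lambda>f. f i)"
      using i by (subst distr_distr) (auto intro!: distr_cong)
    also have "\<dots> = distr (\<Pi>\<^sub>M i\<in>I. density lborel std_normal_density) (density lborel std_normal_density) (\<lambda>f. f i)"
      unfolding R by (intro distr_cong) auto
    also have "\<dots> = density lborel std_normal_density"
      using i by (intro distr_PiM_component prob_space_std_normal)
    finally show ?thesis .
  qed
  have "?J = (\<Pi>\<^sub>M i\<in>I. distr M borel (Z i))"
    unfolding R by (intro PiM_cong) (auto simp: marg)
  then have "indep_vars (\<lambda>_. borel) Z I"
    using indep_vars_iff_distr_eq_PiM'[of I Z "\<lambda>_. borel"] assms by auto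
  moreover have "distributed M lborel (Z i) std_normal_density" if "i \<in> I" for i
    using marg[OF that] that unfolding distributed_def
    by (auto intro: distr_cong[THEN trans])
  ultimately show ?L by (auto simp: iid_std_normal_def)
qed

lemma iid_std_normal_measurable:
  "iid_std_normal M Z I \<Longrightarrow> i \<in> I \<Longrightarrow> Z i \<in> borel_measurable M"
  unfolding iid_std_normal_def by (auto simp: distributed_def)

lemma (in prob_space) iid_std_normal_reindex:
  assumes Z: "iid_std_normal M Z I" and I: "finite I" and J: "J \<noteq> {}" and f: "inj_on f J" "f \<in> J \<rightarrow> I"
  shows "iid_std_normal M (\<lambda>j. Z (f j)) J"
proof -
  let ?N = "density lborel std_normal_density"
  have meas[measurable]: "Z i \<in> borel_measurable M" if "i \<in> I" for i
    using Z that by (rule iid_std_normal_measurable)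
  have fI: "f j \<in> I" if "j \<in> J" for j using f that by auto
  have J_fin: "finite J" and I_ne: "I \<noteq> {}"
    using I f J by (auto intro: inj_on_finite)
  have proj: "(\<lambda>x. \<lambda>j\<in>J. x (f j)) \<in> (\<Pi>\<^sub>M i\<in>I. borel) \<rightarrow>\<^sub>M (\<Pi>\<^sub>M j\<in>J. (borel :: real measure))"
    by (intro measurable_restrict measurable_component_singleton fI)
  have "distr M (\<Pi>\<^sub>M j\<in>J. borel) (\<lambda>\<omega>. \<lambda>j\<in>J. Z (f j) \<omega>) =
      distr (distr M (\<Pi>\<^sub>M i\<in>I. borel) (\<lambda>\<omega>. \<lambda>i\<in>I. Z i \<omega>)) (\<Pi>\<^sub>M j\<in>J. borel) (\<lambda>x. \<lambda>j\<in>J. x (f j))"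
    using fI proj
    by (subst distr_distr) (auto intro!: distr_cong simp: restrict_def[of _ J])
  also have "\<dots> = distr (\<Pi>\<^sub>M i\<in>I. ?N) (\<Pi>\<^sub>M j\<in>J. ?N) (\<lambda>x. \<lambda>j\<in>J. x (f j))"
    using Z I I_ne by (intro distr_cong) (auto simp: iid_std_normal_iff_distr_PiM intro!: sets_PiM_cong)
  also have "\<dots> = (\<Pi>\<^sub>M j\<in>J. ?N)"
    using f by (intro distr_PiM_reindex prob_space_std_normal)
  finally show ?thesis
    using J_fin J fI by (subst iid_std_normal_iff_distr_PiM) auto
qed

text \<open>
  The joint density is a product of one-dimensional densities, and the exponents add up to the squared
  norm: the density depends on the norm only, which is the source of rotation invariance.
\<close>

lemma (in prob_space) iid_std_normal_Basis_density:
  fixes E :: "'a \<Rightarrow> 'b::euclidean_space"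
  assumes [measurable]: "E \<in> borel_measurable M" and E: "iid_std_normal M (\<lambda>b \<omega>. E \<omega> \<bullet> b) Basis"
  shows "distr M borel E = density lborel (\<lambda>x. ennreal ((1 / sqrt (2 * pi)) ^ DIM('b) * exp (- (norm x)\<^sup>2 / 2)))"
proof -
  let ?N = "density lborel std_normal_density"
  let ?\<Phi> = "\<lambda>f::'b \<Rightarrow> real. \<Sum>b\<in>Basis. f b *\<^sub>R b"
  have prod: "(\<Prod>b\<in>Basis. ennreal (std_normal_density (x \<bullet> b))) =
      ennreal ((1 / sqrt (2 * pi)) ^ DIM('b) * exp (- (norm x)\<^sup>2 / 2))" for x :: 'b
  proof -
    have "(\<Prod>b\<in>Basis. std_normal_density (x \<bullet> b)) =
        (1 / sqrt (2 * pi)) ^ DIM('b) * exp (\<Sum>b\<in>Basis. - (x \<bullet> b)\<^sup>2 / 2)"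
      unfolding std_normal_density_def by (simp add: prod.distrib exp_sum power_divide prod_dividef)
    also have "(\<Sum>b\<in>Basis. - (x \<bullet> b)\<^sup>2 / 2) = - (norm x)\<^sup>2 / 2"
      unfolding power2_norm_eq_inner by (subst euclidean_inner) (simp add: sum_negf sum_divide_distrib power2_eq_square)
    finally show ?thesis
      by (simp add: prod_ennreal normal_density_nonneg)
  qed
  have J: "distr M (\<Pi>\<^sub>M i\<in>Basis. borel) (\<lambda>\<omega>. \<lambda>b\<in>Basis. E \<omega> \<bullet> b) = (\<Pi>\<^sub>M i\<in>Basis. ?N)"
    using E iid_std_normal_iff_distr_PiM[of Basis "\<lambda>b \<omega>. E \<omega> \<bullet> b"]
    by simp
  have [measurable]: "?\<Phi> \<in> borel_measurable (\<Pi>\<^sub>M i\<in>Basis. borel)"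
    by measurable
  have [measurable]: "?\<Phi> \<in> borel_measurable (\<Pi>\<^sub>M i\<in>Basis. lborel)"
    by measurable
  have "distr M borel E = distr (distr M (\<Pi>\<^sub>M i\<in>Basis. borel) (\<lambda>\<omega>. \<lambda>b\<in>Basis. E \<omega> \<bullet> b)) borel ?\<Phi>"
    by (subst distr_distr) (auto simp: comp_def euclidean_representation)
  also have "\<dots> = distr (density (\<Pi>\<^sub>M i\<in>Basis. lborel) (\<lambda>f. \<Prod>b\<in>Basis. ennreal (std_normal_density (f b)))) borel ?\<Phi>"
    unfolding J
    by (subst PiM_density_eq)
      (auto intro: prob_space_imp_sigma_finite prob_space_std_normal sigma_finite_lborel)
  also have "\<dots> = distr (density (\<Pi>\<^sub>M i\<in>Basis. lborel) (\<lambda>f. \<Prod>b\<in>Basis. ennreal (std_normal_density (?\<Phi> f \<bullet> b)))) borel ?\<Phi>"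
    by (intro arg_cong2[where f="\<lambda>u v. distr u borel v"] refl density_cong)
      (auto intro!: prod.cong simp: inner_sum_left inner_Basis if_distrib cong: if_cong)
  also have "\<dots> = density (distr (\<Pi>\<^sub>M i\<in>Basis. lborel) borel ?\<Phi>) (\<lambda>x. \<Prod>b\<in>Basis. ennreal (std_normal_density (x \<bullet> b)))"
    by (rule density_distr[symmetric]) measurable
  also have "\<dots> = density lborel (\<lambda>x. \<Prod>b\<in>Basis. ennreal (std_normal_density (x \<bullet> b)))"
    by (simp flip: lborel_eq)
  finally show ?thesis by (simp add: prod)
qed

text \<open>
  An orthogonal map preserves both the density, a function of the norm, and Lebesgue measure; so the law
  of the transformed vector is unchanged.
\<close>

lemma (in prob_space) iid_std_normal_orthogonal_transformation:
  fixes E :: "'a \<Rightarrow> 'b::euclidean_space" and T :: "'b \<Rightarrow> 'b"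
  assumes E_meas[measurable]: "E \<in> borel_measurable M" and E: "iid_std_normal M (\<lambda>b \<omega>. E \<omega> \<bullet> b) Basis"
    and T: "orthogonal_transformation T"
  shows "iid_std_normal M (\<lambda>b \<omega>. T (E \<omega>) \<bullet> b) Basis"
proof -
  have [measurable]: "T \<in> borel_measurable borel"
    using orthogonal_transformation_linear[OF T]
    by (intro borel_measurable_continuous_onI linear_continuous_on) (simp add: linear_conv_bounded_linear)
  let ?d = "\<lambda>x::'b. ennreal ((1 / sqrt (2 * pi)) ^ DIM('b) * exp (- (norm x)\<^sup>2 / 2))"
  let ?c = "\<lambda>x::'b. \<lambda>b\<in>Basis. x \<bullet> b"
  have law: "distr M borel E = density lborel ?d"
    using E_meas E by (rule iid_std_normal_Basis_density)
  have "distr M borel (\<lambda>\<omega>. T (E \<omega>)) = distr (distr M borel E) borel T"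
    by (subst distr_distr) (auto simp: comp_def)
  also have "\<dots> = distr (density lborel ?d) borel T"
    by (simp only: law)
  also have "\<dots> = distr (density lborel (\<lambda>x. ?d (T x))) borel T"
    by (simp add: orthogonal_transformation_norm[OF T])
  also have "\<dots> = density (distr lborel borel T) ?d"
    by (rule density_distr[symmetric]) measurable
  also have "\<dots> = distr M borel E"
    by (simp add: lborel_distr_orthogonal_transformation[OF T] law)
  finally have eq: "distr M borel (\<lambda>\<omega>. T (E \<omega>)) = distr M borel E" .
  have coords: "distr M (\<Pi>\<^sub>M i\<in>Basis. borel) (\<lambda>\<omega>. ?c (F \<omega>)) = distr (distr M borel F) (\<Pi>\<^sub>M i\<in>Basis. borel) ?c"
    if [measurable]: "F \<in> borel_measurable M" for F
    by (subst distr_distr) (auto simp: comp_def)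
  have "distr M (\<Pi>\<^sub>M i\<in>Basis. borel) (\<lambda>\<omega>. ?c (T (E \<omega>))) = distr M (\<Pi>\<^sub>M i\<in>Basis. borel) (\<lambda>\<omega>. ?c (E \<omega>))"
    by (simp add: coords eq)
  then show ?thesis
    using E iid_std_normal_iff_distr_PiM[of Basis "\<lambda>b \<omega>. E \<omega> \<bullet> b"]
      iid_std_normal_iff_distr_PiM[of Basis "\<lambda>b \<omega>. T (E \<omega>) \<bullet> b"]
    by simp
qed

definition orthonormal :: "'a::real_inner set \<Rightarrow> bool" where
  "orthonormal B \<longleftrightarrow> pairwise orthogonal B \<and> (\<forall>b\<in>B. norm b = 1)"

lemma orthonormal_inner:
  "orthonormal B \<Longrightarrow> b \<in> B \<Longrightarrow> c \<in> B \<Longrightarrow> b \<bullet> c = (if b = c then 1 else 0)"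
  by (auto simp: orthonormal_def pairwise_def orthogonal_def dot_square_norm)

lemma orthonormal_finite: "orthonormal B \<Longrightarrow> finite (B :: 'a::euclidean_space set)"
  by (auto simp: orthonormal_def intro: pairwise_orthogonal_imp_finite)

lemma orthonormal_independent: "orthonormal B \<Longrightarrow> independent (B :: 'a::euclidean_space set)"
  by (rule pairwise_orthogonal_independent) (auto simp: orthonormal_def)

lemma norm_sum_orthonormal:
  fixes B :: "'a::euclidean_space set"
  assumes B: "orthonormal B"
  shows "(norm (\<Sum>b\<in>B. c b *\<^sub>R b))\<^sup>2 = (\<Sum>b\<in>B. (c b)\<^sup>2)"
  unfolding power2_norm_eq_inner inner_sum_left inner_sum_right
  by (intro sum.cong refl) (simp add: orthonormal_inner[OF B] orthonormal_finite[OF B] power2_eq_square sum.delta if_distrib cong: if_cong)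

text \<open>
  Coordinates in the basis \<open>B\<close> are standard coordinates after the orthogonal map that sends \<open>B\<close> to
  the standard basis; it is orthogonal because the coordinates in \<open>B\<close> satisfy Parseval's identity.
\<close>

lemma (in prob_space) iid_std_normal_orthonormal:
  fixes E :: "'a \<Rightarrow> 'b::euclidean_space"
  assumes [measurable]: "E \<in> borel_measurable M" and E: "iid_std_normal M (\<lambda>b \<omega>. E \<omega> \<bullet> b) Basis"
    and B: "orthonormal B" and card: "card B = DIM('b)"
  shows "iid_std_normal M (\<lambda>b \<omega>. E \<omega> \<bullet> b) B"
proof -
  have span: "span B = UNIV"
    using orthonormal_independent[OF B] card by (metis dim_eq_card_independent dim_eq_full)
  obtain g where g: "bij_betw g (Basis :: 'b set) B"
    using card orthonormal_finite[OF B] by (metis finite_Basis finite_same_card_bij)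
  define T where "T x = (\<Sum>b\<in>Basis. (x \<bullet> g b) *\<^sub>R b)" for x :: 'b
  have T_inner: "T x \<bullet> b = x \<bullet> g b" if "b \<in> Basis" for x b
    using that by (simp add: T_def inner_sum_left inner_Basis if_distrib cong: if_cong)
  have "orthogonal_transformation T"
    unfolding orthogonal_transformation
  proof (intro conjI allI)
    show "linear T"
      unfolding T_def by (intro linear_compose_sum ballI linearI) (auto simp: inner_add_left algebra_simps)
    fix x
    have "(norm (T x))\<^sup>2 = (\<Sum>b\<in>Basis. (x \<bullet> g b)\<^sup>2)"
      unfolding power2_norm_eq_inner by (subst euclidean_inner) (simp add: T_inner power2_eq_square)
    also have "\<dots> = (\<Sum>b\<in>B. (x \<bullet> b)\<^sup>2)"
      using g by (rule sum.reindex_bij_betw)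
    also have "\<dots> = (norm (\<Sum>b\<in>B. (x \<bullet> b) *\<^sub>R b))\<^sup>2"
      by (rule norm_sum_orthonormal[OF B, symmetric])
    also have "(\<Sum>b\<in>B. (x \<bullet> b) *\<^sub>R b) = x"
      using B span orthonormal_finite[OF B] unfolding orthonormal_def
      by (intro orthonormal_basis_expand) auto
    finally show "norm (T x) = norm x" by simp
  qed
  then have TE: "iid_std_normal M (\<lambda>b \<omega>. T (E \<omega>) \<bullet> b) Basis"
    by (rule iid_std_normal_orthogonal_transformation[OF assms(1) E])
  define h where "h = the_inv_into Basis g"
  have h: "bij_betw h B Basis"
    unfolding h_def using g by (rule bij_betw_the_inv_into)
  have gh: "g (h b) = b" if "b \<in> B" for b
    unfolding h_def using g that by (meson bij_betw_def f_the_inv_into_f_bij_betw)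
  have hB: "h b \<in> Basis" if "b \<in> B" for b
    using h that by (auto simp: bij_betw_def)
  have eq: "T (E \<omega>) \<bullet> h b = E \<omega> \<bullet> b" if "b \<in> B" for \<omega> b
    using that by (simp add: T_inner hB gh)
  have "B \<noteq> {}" using card by auto
  then have "iid_std_normal M (\<lambda>b \<omega>. T (E \<omega>) \<bullet> h b) B"
    using h by (intro iid_std_normal_reindex[OF TE]) (auto simp: bij_betw_def)
  moreover have "distributed M lborel (\<lambda>\<omega>. T (E \<omega>) \<bullet> h b) std_normal_density \<longleftrightarrow>
      distributed M lborel (\<lambda>\<omega>. E \<omega> \<bullet> b) std_normal_density" if "b \<in> B" for b
    using that by (simp add: eq)
  ultimately show ?thesis
    unfolding iid_std_normal_def
    by (simp add: eq cong: indep_vars_cong)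
qed

section \<open>Chi-square laws\<close>

lemma iid_std_normal_subset:
  "prob_space M \<Longrightarrow> iid_std_normal M Z I \<Longrightarrow> J \<subseteq> I \<Longrightarrow> iid_std_normal M Z J"
  unfolding iid_std_normal_def by (auto intro: prob_space.indep_vars_subset)

lemma (in prob_space) iid_std_normal_moments:
  assumes Z: "iid_std_normal M Z I" and i: "i \<in> I"
  shows "integrable M (Z i)" "expectation (Z i) = 0"
    "integrable M (\<lambda>\<omega>. (Z i \<omega>)\<^sup>2)" "expectation (\<lambda>\<omega>. (Z i \<omega>)\<^sup>2) = 1"
proof -
  have D: "distributed M lborel (Z i) std_normal_density"
    using Z i by (simp add: iid_std_normal_def)
  show "integrable M (Z i)"
    using distributed_integrable[OF D, of "\<lambda>x. x"] integrable_std_normal_moment[of 1]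
    by (simp add: normal_density_nonneg)
  show "expectation (Z i) = 0"
    using D by (rule standard_normal_distributed_expectation)
  show "integrable M (\<lambda>\<omega>. (Z i \<omega>)\<^sup>2)"
    using distributed_integrable[OF D, of "\<lambda>x. x\<^sup>2"] integrable_std_normal_moment[of 2]
    by (simp add: normal_density_nonneg)
  show "expectation (\<lambda>\<omega>. (Z i \<omega>)\<^sup>2) = 1"
    using distributed_integral[OF D, of "\<lambda>x. x\<^sup>2"] integral_std_normal_moment_even[of 1]
    by (simp add: normal_density_nonneg)
qed

lemma sets_chi_square [simp, measurable_cong]: "sets (chi_square k) = sets borel"
  and space_chi_square [simp]: "space (chi_square k) = UNIV"
  by (auto simp: chi_square_def)

lemma (in prob_space) chi_square_distr:
  assumes Z: "iid_std_normal M Z I" and I: "finite I" "I \<noteq> {}"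
  shows "distr M borel (\<lambda>\<omega>. \<Sum>i\<in>I. (Z i \<omega>)\<^sup>2) = chi_square (card I)"
proof -
  let ?k = "card I"
  let ?N = "density lborel std_normal_density"
  have k: "{..<?k} \<noteq> {}" using I by (simp add: lessThan_empty_iff card_gt_0_iff)
  obtain f where f: "bij_betw f {..<?k} I"
    using I by (metis card_lessThan finite_lessThan finite_same_card_bij)
  have Zf: "iid_std_normal M (\<lambda>j. Z (f j)) {..<?k}"
    using f by (intro iid_std_normal_reindex[OF Z I(1) k]) (auto simp: bij_betw_def)
  have meas[measurable]: "\<And>j. j \<in> {..<?k} \<Longrightarrow> Z (f j) \<in> borel_measurable M"
    using iid_std_normal_measurable[OF Zf] by simp
  have "distr M borel (\<lambda>\<omega>. \<Sum>i\<in>I. (Z i \<omega>)\<^sup>2) = distr M borel (\<lambda>\<omega>. \<Sum>j<?k. (Z (f j) \<omega>)\<^sup>2)"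
    using sum.reindex_bij_betw[OF f, of "\<lambda>i. (Z i \<omega>)\<^sup>2" for \<omega>] by simp
  also have "\<dots> = distr (distr M (\<Pi>\<^sub>M i\<in>{..<?k}. borel) (\<lambda>\<omega>. \<lambda>i\<in>{..<?k}. Z (f i) \<omega>)) borel (\<lambda>x. \<Sum>i<?k. (x i)\<^sup>2)"
    by (subst distr_distr) (auto simp: comp_def)
  also have "\<dots> = chi_square ?k"
    using Zf k by (simp add: iid_std_normal_iff_distr_PiM chi_square_def)
  finally show ?thesis .
qed

text \<open>
  Sums over disjoint parts of an independent family are independent, so their joint law is the product
  of two \<open>\<chi>\<^sup>2\<close> laws, the form in which \<open>Dkhi\<close> is defined.
\<close>

lemma (in prob_space) chi_square_pair_distr:
  assumes Z: "iid_std_normal M Z (A \<union> C)" and fin: "finite A" "finite C" "A \<noteq> {}" "C \<noteq> {}"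
    and disj: "A \<inter> C = {}"
  shows "distr M (borel \<Otimes>\<^sub>M borel) (\<lambda>\<omega>. (\<Sum>i\<in>A. (Z i \<omega>)\<^sup>2, \<Sum>i\<in>C. (Z i \<omega>)\<^sup>2)) =
    chi_square (card A) \<Otimes>\<^sub>M chi_square (card C)"
proof -
  have ZA: "iid_std_normal M Z A" and ZC: "iid_std_normal M Z C"
    using Z prob_space_axioms by (auto intro: iid_std_normal_subset)
  have "indep_var (PiM A (\<lambda>_. borel)) (\<lambda>\<omega>. restrict (\<lambda>i. Z i \<omega>) A) (PiM C (\<lambda>_. borel)) (\<lambda>\<omega>. restrict (\<lambda>i. Z i \<omega>) C)"
    using Z disj by (intro indep_var_restrict) (auto simp: iid_std_normal_def)
  then have "indep_var borel ((\<lambda>x. \<Sum>i\<in>A. (x i)\<^sup>2) \<circ> (\<lambda>\<omega>. restrict (\<lambda>i. Z i \<omega>) A))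
      borel ((\<lambda>x. \<Sum>i\<in>C. (x i)\<^sup>2) \<circ> (\<lambda>\<omega>. restrict (\<lambda>i. Z i \<omega>) C))"
    by (rule indep_var_compose) measurable
  then have "indep_var borel (\<lambda>\<omega>. \<Sum>i\<in>A. (Z i \<omega>)\<^sup>2) borel (\<lambda>\<omega>. \<Sum>i\<in>C. (Z i \<omega>)\<^sup>2)"
    by (simp add: comp_def)
  then have "distr M borel (\<lambda>\<omega>. \<Sum>i\<in>A. (Z i \<omega>)\<^sup>2) \<Otimes>\<^sub>M distr M borel (\<lambda>\<omega>. \<Sum>i\<in>C. (Z i \<omega>)\<^sup>2) =
    distr M (borel \<Otimes>\<^sub>M borel) (\<lambda>\<omega>. (\<Sum>i\<in>A. (Z i \<omega>)\<^sup>2, \<Sum>i\<in>C. (Z i \<omega>)\<^sup>2))"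
    unfolding indep_var_distribution_eq by blast
  then show ?thesis
    using ZA ZC fin by (simp add: chi_square_distr)
qed

lemma prob_space_chi_square: "prob_space (chi_square k)"
  unfolding chi_square_def
  by (intro prob_space.prob_space_distr prob_space_PiM prob_space_std_normal) measurable

lemma AE_chi_square_nonneg: "AE u in chi_square k. 0 \<le> u"
  unfolding chi_square_def by (subst AE_distr_iff) (auto intro!: sum_nonneg)

lemma AE_chi_square_pos:
  assumes "0 < k"
  shows "AE u in chi_square k. 0 < u"
proof -
  let ?N = "density lborel std_normal_density"
  have "AE x in lborel. x \<noteq> (0::real)" by (rule AE_lborel_singleton)
  then have "AE x in ?N. x \<noteq> (0::real)"
    by (subst AE_density) auto
  then have "AE x in (\<Pi>\<^sub>M i\<in>{..<k}. ?N). x 0 \<noteq> 0"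
    using assms by (intro AE_PiM_component prob_space_std_normal) auto
  then have "AE x in (\<Pi>\<^sub>M i\<in>{..<k}. ?N). 0 < (\<Sum>i<k. (x i)\<^sup>2)"
  proof eventually_elim
    case (elim x)
    then show ?case using assms by (intro sum_pos2[of _ 0]) auto
  qed
  then show ?thesis
    unfolding chi_square_def by (subst AE_distr_iff) auto
qed

lemma integrable_chi_square: "integrable (chi_square k) (\<lambda>u. u)"
  and integral_chi_square: "(LINT u|chi_square k. u) = real k"
proof -
  let ?N = "density lborel std_normal_density"
  let ?Q = "\<Pi>\<^sub>M i\<in>{..<k}. ?N"
  have N: "has_bochner_integral ?N (\<lambda>x. x\<^sup>2) 1"
    using std_normal_moment_even[of 1] integrable_std_normal_moment[of 2]
      integral_density[of "\<lambda>x::real. x\<^sup>2" lborel std_normal_density]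
    by (auto simp: has_bochner_integral_iff integrable_density normal_density_nonneg)
  have "has_bochner_integral ?Q (\<lambda>x. (x i)\<^sup>2) 1" if i: "i \<in> {..<k}" for i
  proof -
    have *: "distr ?Q ?N (\<lambda>x. x i) = ?N"
      using i by (intro distr_PiM_component prob_space_std_normal)
    have meas: "(\<lambda>x. x i) \<in> ?Q \<rightarrow>\<^sub>M ?N" "(\<lambda>x::real. x\<^sup>2) \<in> borel_measurable ?N"
      using i by (auto intro: measurable_component_singleton)
    have "has_bochner_integral (distr ?Q ?N (\<lambda>x. x i)) (\<lambda>x. x\<^sup>2) 1"
      unfolding * by (rule N)
    then show ?thesis
      by (simp only: has_bochner_integral_iff integrable_distr_eq[OF meas] integral_distr[OF meas])
  qed
  then have "has_bochner_integral ?Q (\<lambda>x. \<Sum>i\<in>{..<k}. (x i)\<^sup>2) (\<Sum>i\<in>{..<k}. 1)"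
    by (intro has_bochner_integral_sum) auto
  then have "has_bochner_integral (chi_square k) (\<lambda>u. u) (real k)"
    unfolding chi_square_def by (subst has_bochner_integral_distr) auto
  then show "integrable (chi_square k) (\<lambda>u. u)" "(LINT u|chi_square k. u) = real k"
    by (auto simp: has_bochner_integral_iff)
qed

lemma measure_std_normal_tail_pos:
  "0 < measure (density lborel std_normal_density) {x. c \<le> x\<^sup>2}" (is "0 < measure ?N ?A")
proof -
  interpret N: prob_space ?N by (rule prob_space_std_normal)
  have "?A \<notin> null_sets ?N"
  proof
    assume "?A \<in> null_sets ?N"
    then have "AE x in ?N. x \<notin> ?A" by (rule AE_not_in)
    then have "AE x in lborel. x \<notin> ?A"
      by (subst (asm) AE_density) (auto simp: normal_density_pos)
    then have "AE x in lborel. x \<notin> {max c 1 .. max c 1 + 1}"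
    proof eventually_elim
      case (elim x)
      show ?case
      proof
        assume "x \<in> {max c 1 .. max c 1 + 1}"
        then have "c \<le> x" "1 \<le> x" by auto
        then have "c \<le> x\<^sup>2" using self_le_power[of x 2] by simp
        with elim show False by simp
      qed
    qed
    then have "{max c 1 .. max c 1 + 1} \<in> null_sets lborel"
      by (subst (asm) AE_iff_null_sets[symmetric]) auto
    then show False by (simp add: null_sets_def)
  qed
  then have "emeasure ?N ?A \<noteq> 0"
    by (auto simp: null_sets_def)
  then show ?thesis
    by (simp add: N.emeasure_eq_measure zero_less_measure_iff)
qed

text \<open>
  Keeping a single square yields a lower bound on the tail that does not depend on the number of degrees
  of freedom, hence is uniform over all models.
\<close>

lemma chi_square_tail_ge:
  assumes "0 < k"
  shows "measure (density lborel std_normal_density) {x. c \<le> x\<^sup>2} \<le> measure (chi_square k) {c..}"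
proof -
  let ?N = "density lborel std_normal_density"
  let ?Q = "\<Pi>\<^sub>M i\<in>{..<k}. ?N"
  interpret Q: prob_space ?Q by (intro prob_space_PiM prob_space_std_normal)
  have "measure ?N {x. c \<le> x\<^sup>2} = measure (distr ?Q ?N (\<lambda>x. x 0)) {x. c \<le> x\<^sup>2}"
    using assms by (subst distr_PiM_component) (auto intro: prob_space_std_normal)
  also have "\<dots> = measure ?Q {x \<in> space ?Q. c \<le> (x 0)\<^sup>2}"
    using assms by (subst measure_distr) (auto intro!: arg_cong2[where f=measure])
  also have "\<dots> \<le> measure ?Q {x \<in> space ?Q. c \<le> (\<Sum>i<k. (x i)\<^sup>2)}"
    using assms
    by (intro Q.finite_measure_mono) (auto intro: order_trans[OF _ member_le_sum[of 0]])
  also have "\<dots> = measure (chi_square k) {c..}"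
    unfolding chi_square_def by (subst measure_distr) (auto intro!: arg_cong2[where f=measure])
  finally show ?thesis .
qed

section \<open>The function Dkhi and its inverse\<close>

abbreviation chi_square_pair :: "nat \<Rightarrow> nat \<Rightarrow> (real \<times> real) measure" where
  "chi_square_pair D N \<equiv> chi_square D \<Otimes>\<^sub>M chi_square N"

lemma prob_space_chi_square_pair: "prob_space (chi_square_pair D N)"
proof -
  interpret C1: prob_space "chi_square D" by (rule prob_space_chi_square)
  interpret C2: prob_space "chi_square N" by (rule prob_space_chi_square)
  interpret pair_prob_space "chi_square D" "chi_square N" ..
  show ?thesis by (rule prob_space_axioms)
qed

lemma chi_square_pair_marginals:
  shows chi_square_pair_fst: "distr (chi_square_pair D N) (chi_square D) fst = chi_square D"
    and chi_square_pair_snd: "distr (chi_square_pair D N) (chi_square N) snd = chi_square N"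
proof -
  interpret C1: prob_space "chi_square D" by (rule prob_space_chi_square)
  interpret C2: prob_space "chi_square N" by (rule prob_space_chi_square)
  show "distr (chi_square_pair D N) (chi_square D) fst = chi_square D"
  proof (rule measure_eqI)
    fix A assume "A \<in> sets (distr (chi_square_pair D N) (chi_square D) fst)"
    then have A: "A \<in> sets (chi_square D)" by simp
    have "fst -` A \<inter> space (chi_square_pair D N) = A \<times> space (chi_square N)"
      by (auto simp: space_pair_measure)
    then show "emeasure (distr (chi_square_pair D N) (chi_square D) fst) A = emeasure (chi_square D) A"
      using A by (simp add: emeasure_distr C2.emeasure_pair_measure_Times C2.emeasure_space_1 del: space_chi_square sets_chi_square)
  qed simp
  show "distr (chi_square_pair D N) (chi_square N) snd = chi_square N"
  proof (rule measure_eqI)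
    fix A assume "A \<in> sets (distr (chi_square_pair D N) (chi_square N) snd)"
    then have A: "A \<in> sets (chi_square N)" by simp
    have "snd -` A \<inter> space (chi_square_pair D N) = space (chi_square D) \<times> A"
      by (auto simp: space_pair_measure)
    then show "emeasure (distr (chi_square_pair D N) (chi_square N) snd) A = emeasure (chi_square N) A"
      using A by (simp add: emeasure_distr C2.emeasure_pair_measure_Times C1.emeasure_space_1 del: space_chi_square sets_chi_square)
  qed simp
qed

lemma integrable_chi_square_pair [simp]:
  "integrable (chi_square_pair D N) fst" "integrable (chi_square_pair D N) snd"
proof -
  have "integrable (distr (chi_square_pair D N) (chi_square D) fst) (\<lambda>u. u)"
    unfolding chi_square_pair_fst by (rule integrable_chi_square)
  then show "integrable (chi_square_pair D N) fst"
    by (subst (asm) integrable_distr_eq) (auto simp: measurable_ident_sets)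
  have "integrable (distr (chi_square_pair D N) (chi_square N) snd) (\<lambda>u. u)"
    unfolding chi_square_pair_snd by (rule integrable_chi_square)
  then show "integrable (chi_square_pair D N) snd"
    by (subst (asm) integrable_distr_eq) (auto simp: measurable_ident_sets)
qed

lemma integral_chi_square_pair_fst: "(LINT z|chi_square_pair D N. fst z) = real D"
  using integral_chi_square[of D] integral_distr[of fst "chi_square_pair D N" "chi_square D" "\<lambda>u. u"]
  by (simp add: chi_square_pair_fst measurable_ident_sets)

lemma AE_chi_square_pair_fst:
  assumes "AE u in chi_square D. Q u"
  shows "AE z in chi_square_pair D N. Q (fst z)"
proof (rule AE_distrD[of fst _ "chi_square D"])
  show "AE u in distr (chi_square_pair D N) (chi_square D) fst. Q u"
    unfolding chi_square_pair_fst by (rule assms)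
qed simp

lemma AE_chi_square_pair_snd:
  assumes "AE u in chi_square N. Q u"
  shows "AE z in chi_square_pair D N. Q (snd z)"
proof (rule AE_distrD[of snd _ "chi_square N"])
  show "AE u in distr (chi_square_pair D N) (chi_square N) snd. Q u"
    unfolding chi_square_pair_snd by (rule assms)
qed simp

text \<open>
  The numerator of \<open>Dkhi\<close>: the mean excess of a \<open>\<chi>\<^sup>2\<close> variable over \<open>x\<close> times an independent
  normalized one.
\<close>

definition excess :: "nat \<Rightarrow> nat \<Rightarrow> real \<Rightarrow> real" where
  "excess D N x = (LINT (u, v)|chi_square_pair D N. max (u - x * (v / real N)) 0)"

lemma Dkhi_eq_excess: "Dkhi D N x = excess D N x / real D"
  by (simp add: Dkhi_def excess_def integral_chi_square)

lemma excess_eq: "excess D N x = (LINT z|chi_square_pair D N. max (fst z - x * (snd z / real N)) 0)"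
  by (simp add: excess_def case_prod_unfold)

lemma integrable_excess:
  "integrable (chi_square_pair D N) (\<lambda>z. max (fst z - x * (snd z / real N)) 0)"
  by (intro integrable_max Bochner_Integration.integrable_diff integrable_mult_right) simp_all

lemma excess_0: "excess D N 0 = real D"
proof -
  have "excess D N 0 = (LINT z|chi_square_pair D N. fst z)"
    unfolding excess_eq
  proof (rule integral_cong_AE)
    show "AE z in chi_square_pair D N. max (fst z - 0 * (snd z / real N)) 0 = fst z"
      using AE_chi_square_pair_fst[OF AE_chi_square_nonneg] by eventually_elim simp
  qed simp_all
  then show ?thesis by (simp add: integral_chi_square_pair_fst)
qed

lemma excess_convex: "convex_on UNIV (excess D N)"
proof (rule convex_onI)
  fix t x y :: real
  assume t: "0 < t" "t < 1"
  let ?g = "\<lambda>x z. max (fst z - x * (snd z / real N)) 0"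
  have *: "?g ((1 - t) *\<^sub>R x + t *\<^sub>R y) z \<le> (1 - t) * ?g x z + t * ?g y z" for z
  proof -
    have "fst z - ((1 - t) *\<^sub>R x + t *\<^sub>R y) * (snd z / real N) =
        (1 - t) * (fst z - x * (snd z / real N)) + t * (fst z - y * (snd z / real N))"
      by (simp add: algebra_simps add_divide_distrib diff_divide_distrib)
    also have "\<dots> \<le> (1 - t) * ?g x z + t * ?g y z"
      using t by (intro add_mono mult_left_mono) auto
    finally show ?thesis using t by simp
  qed
  have "excess D N ((1 - t) *\<^sub>R x + t *\<^sub>R y) \<le> (LINT z|chi_square_pair D N. (1 - t) * ?g x z + t * ?g y z)"
    unfolding excess_eq
    by (intro integral_mono *) (intro integrable_excess Bochner_Integration.integrable_add integrable_mult_right)+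
  also have "\<dots> = (1 - t) * excess D N x + t * excess D N y"
    unfolding excess_eq by (simp add: integrable_excess)
  finally show "excess D N ((1 - t) *\<^sub>R x + t *\<^sub>R y) \<le> (1 - t) * excess D N x + t * excess D N y" .
qed simp

lemma excess_continuous: "continuous_on A (excess D N)"
  using convex_on_continuous[OF open_UNIV excess_convex] continuous_on_subset by blast

text \<open>
  Dominated convergence: for \<open>x \<ge> 0\<close> the integrand is at most the first variable, and it vanishes for
  large \<open>x\<close> because the second variable is almost surely positive.
\<close>

lemma excess_tendsto_0:
  assumes N: "0 < N"
  shows "(excess D N \<longlongrightarrow> 0) at_top"
proof -
  let ?g = "\<lambda>x z. max (fst z - x * (snd z / real N)) 0"
  have "((\<lambda>x. LINT z|chi_square_pair D N. ?g x z) \<longlongrightarrow> (LINT z|chi_square_pair D N. 0)) at_top"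
  proof (rule integral_dominated_convergence_at_top[where w="\<lambda>z. \<bar>fst z\<bar>"])
    show "\<forall>\<^sub>F x in at_top. AE z in chi_square_pair D N. norm (?g x z) \<le> \<bar>fst z\<bar>"
      using eventually_ge_at_top[of 0]
    proof eventually_elim
      case (elim x)
      show ?case
        using AE_chi_square_pair_snd[OF AE_chi_square_nonneg]
      proof eventually_elim
        case (elim z)
        have "0 \<le> x * (snd z / real N)" using \<open>0 \<le> x\<close> elim by simp
        then show ?case by auto
      qed
    qed
    show "AE z in chi_square_pair D N. ((\<lambda>x. ?g x z) \<longlongrightarrow> 0) at_top"
      using AE_chi_square_pair_snd[OF AE_chi_square_pos[OF N]]
    proof eventually_elim
      case (elim z)
      show ?case
      proof (rule tendsto_eventually)
        show "\<forall>\<^sub>F x in at_top. ?g x z = 0"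
          using eventually_ge_at_top[of "fst z / (snd z / real N)"]
        proof eventually_elim
          case (elim x)
          then show ?case using \<open>0 < snd z\<close> N by (simp add: field_simps)
        qed
      qed
    qed
  qed (auto intro: integrable_abs)
  then show ?thesis by (simp add: excess_eq[abs_def])
qed

text \<open>
  Existence of a solution is the intermediate value theorem. For uniqueness, if a convex function takes
  the value \<open>q\<close> at two points, then it is at least \<open>q\<close> everywhere to the right of them, which
  contradicts the limit 0.
\<close>

lemma EDkhi_inverse:
  assumes D: "0 < D" and N: "0 < N" and q: "0 < q" "q \<le> 1"
  shows "0 \<le> EDkhi D N q" "Dkhi D N (EDkhi D N q) = q"
proof -
  have lim: "(Dkhi D N \<longlongrightarrow> 0) at_top"
    using tendsto_divide[OF excess_tendsto_0[OF N] tendsto_const[of "real D"]] D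
    by (simp add: Dkhi_eq_excess[abs_def])
  have small: "\<forall>\<^sub>F x in at_top. Dkhi D N x < q"
    using lim q by (auto intro: order_tendstoD)
  have Dkhi_0: "Dkhi D N 0 = 1" using D by (simp add: Dkhi_eq_excess excess_0)
  obtain b where b: "0 \<le> b" "Dkhi D N b < q"
    using eventually_conj[OF small eventually_ge_at_top[of 0]] by (auto dest: eventually_happens)
  have cont: "continuous_on {0..b} (Dkhi D N)"
    unfolding Dkhi_eq_excess[abs_def] using D by (intro continuous_intros excess_continuous) auto
  obtain x where x: "0 \<le> x" "Dkhi D N x = q"
    using IVT2'[of "Dkhi D N" b q 0] cont b q Dkhi_0 by auto
  have no: False if "0 \<le> x" "x < y" "Dkhi D N x = q" "Dkhi D N y = q" for x y
  proof -
    have conv: "convex_on UNIV (Dkhi D N)"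
      unfolding Dkhi_eq_excess[abs_def] using convex_on_cdiv[OF _ excess_convex, of "real D"] by simp
    have "\<forall>\<^sub>F z in at_top. Dkhi D N z < q \<and> y < z"
      using small eventually_gt_at_top by (rule eventually_conj)
    then obtain z where z: "Dkhi D N z < q" "y < z" by (auto dest: eventually_happens)
    define t where "t = (y - x) / (z - x)"
    have t: "0 < t" "t \<le> 1" "t * (z - x) = y - x" using that z by (auto simp: t_def)
    have "(1 - t) *\<^sub>R x + t *\<^sub>R z = y" using t by (simp add: algebra_simps)
    then have "q \<le> (1 - t) * q + t * Dkhi D N z"
      using convex_onD[OF conv, of t x z] t that by simp
    then have "t * q \<le> t * Dkhi D N z" by (simp add: algebra_simps)
    with z t show False by simp
  qed
  have "\<exists>!x. 0 \<le> x \<and> Dkhi D N x = q"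
    using x no by (metis linorder_neqE_linordered_idom)
  then have "0 \<le> EDkhi D N q \<and> Dkhi D N (EDkhi D N q) = q"
    unfolding EDkhi_def by (rule theI')
  then show "0 \<le> EDkhi D N q" "Dkhi D N (EDkhi D N q) = q" by auto
qed

text \<open>
  On the product event that the second variable is so small that \<open>x * (v / N) \<le> c\<close> and the first is at
  least \<open>2 * c\<close>, the integrand is at least \<open>c\<close>. Thus a small mean excess forces small values of the
  second variable to be unlikely.
\<close>

lemma excess_tail_bound:
  assumes D: "0 < D" and x: "0 \<le> x" and c: "0 \<le> c"
  shows "measure (chi_square N) {v. x * (v / real N) \<le> c} *
      (c * measure (density lborel std_normal_density) {z. 2 * c \<le> z\<^sup>2}) \<le> excess D N x"
proof -
  let ?A = "{v. x * (v / real N) \<le> c}" and ?B = "{2 * c..}"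
  interpret C1: prob_space "chi_square D" by (rule prob_space_chi_square)
  interpret C2: prob_space "chi_square N" by (rule prob_space_chi_square)
  interpret C: prob_space "chi_square_pair D N" by (rule prob_space_chi_square_pair)
  have [measurable]: "?A \<in> sets borel" by measurable
  have AB: "?B \<times> ?A \<in> sets (chi_square_pair D N)"
    by (intro pair_measureI) (auto simp del: sets_pair_measure)
  have "measure (chi_square_pair D N) (?B \<times> ?A) = measure (chi_square D) ?B * measure (chi_square N) ?A"
    unfolding measure_def by (subst C2.emeasure_pair_measure_Times) (auto simp: enn2real_mult)
  then have "measure (chi_square N) ?A * (c * measure (chi_square D) ?B) =
      (LINT z|chi_square_pair D N. c * indicator (?B \<times> ?A) z)"
    using AB by (simp add: integral_mult_right_zero)
  also have "\<dots> \<le> excess D N x"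
    unfolding excess_eq
  proof (intro integral_mono integrable_excess)
    show "integrable (chi_square_pair D N) (\<lambda>z. c * indicator (?B \<times> ?A) z)"
      using AB by (intro integrable_mult_right integrable_real_indicator) (auto simp: C.emeasure_eq_measure)
    fix z assume "z \<in> space (chi_square_pair D N)"
    show "c * indicator (?B \<times> ?A) z \<le> max (fst z - x * (snd z / real N)) 0"
      by (cases z) (auto simp: indicator_def)
  qed
  finally show ?thesis
    using chi_square_tail_ge[OF D, of "2 * c"] c
    by (meson mult_left_mono measure_nonneg order_trans)
qed

section \<open>Orthogonal projections and the pathwise risk bound\<close>

lemma
  fixes S :: "'a::euclidean_space set"
  assumes "subspace S"
  shows orth_proj_in: "orth_proj S x \<in> S"
    and orth_proj_orthogonal: "v \<in> S \<Longrightarrow> (x - orth_proj S x) \<bullet> v = 0"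
  using theI'[OF orth_proj_ex1[OF assms, of x]] unfolding orth_proj_def orthogonal_def by auto

lemma orth_proj_eqI:
  fixes S :: "'a::euclidean_space set"
  assumes "subspace S" "p \<in> S" "\<And>v. v \<in> S \<Longrightarrow> (x - p) \<bullet> v = 0"
  shows "orth_proj S x = p"
  unfolding orth_proj_def
  by (rule the1_equality[OF orth_proj_ex1[OF assms(1)]]) (use assms in \<open>auto simp: orthogonal_def\<close>)

lemma orth_proj_affine:
  fixes S :: "'a::euclidean_space set"
  assumes S: "subspace S"
  shows "orth_proj S (x + c *\<^sub>R z) = orth_proj S x + c *\<^sub>R orth_proj S z"
proof (rule orth_proj_eqI[OF S])
  show "orth_proj S x + c *\<^sub>R orth_proj S z \<in> S"
    by (intro subspace_add subspace_scale S orth_proj_in)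
  fix v assume v: "v \<in> S"
  have "x + c *\<^sub>R z - (orth_proj S x + c *\<^sub>R orth_proj S z) = (x - orth_proj S x) + c *\<^sub>R (z - orth_proj S z)"
    by (simp add: algebra_simps)
  then show "(x + c *\<^sub>R z - (orth_proj S x + c *\<^sub>R orth_proj S z)) \<bullet> v = 0"
    by (simp only: inner_add_left inner_scaleR_left orth_proj_orthogonal[OF S v])
qed

lemma norm_orth_proj_le:
  fixes S :: "'a::euclidean_space set"
  assumes S: "subspace S"
  shows "norm (orth_proj S x) \<le> norm x"
proof -
  have "orthogonal (x - orth_proj S x) (orth_proj S x)"
    using S by (auto simp: orthogonal_def intro: orth_proj_orthogonal orth_proj_in)
  then have "(norm x)\<^sup>2 = (norm (x - orth_proj S x))\<^sup>2 + (norm (orth_proj S x))\<^sup>2"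
    using norm_add_Pythagorean by fastforce
  then have "(norm (orth_proj S x))\<^sup>2 \<le> (norm x)\<^sup>2" by simp
  then show ?thesis by (rule power2_le_imp_le) simp
qed

lemma norm_orth_proj_orthonormal:
  fixes S :: "'a::euclidean_space set"
  assumes B: "orthonormal B" "span B = S"
  shows "(norm (orth_proj S z))\<^sup>2 = (\<Sum>b\<in>B. (z \<bullet> b)\<^sup>2)"
proof -
  have S: "subspace S" using B(2) by (metis subspace_span)
  have "orth_proj S z = (\<Sum>b\<in>B. (z \<bullet> b) *\<^sub>R b)"
  proof -
    have "orth_proj S z = (\<Sum>b\<in>B. (orth_proj S z \<bullet> b) *\<^sub>R b)"
      using B orth_proj_in[OF S, of z] orthonormal_finite[OF B(1)] unfolding orthonormal_def
      by (intro orthonormal_basis_expand[symmetric]) auto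
    also have "\<dots> = (\<Sum>b\<in>B. (z \<bullet> b) *\<^sub>R b)"
      using orth_proj_orthogonal[OF S _ , of _ z] B(2) span_base[of _ B]
      by (intro sum.cong refl) (auto simp: inner_diff_left)
    finally show ?thesis .
  qed
  then show ?thesis by (simp add: norm_sum_orthonormal[OF B(1)])
qed

text \<open>
  The basis is split into a basis \<open>B\<close> of \<open>S\<close>, one direction \<open>u\<close> that carries the whole bias of \<open>\<mu>\<close>,
  and the rest \<open>C\<close>, on which \<open>\<mu>\<close> has no component.
\<close>

lemma adapted_orthonormal_basis:
  fixes S :: "'a::euclidean_space set"
  assumes S: "subspace S" and dim: "dim S < DIM('a)"
  obtains B u C c where
    "orthonormal (insert u (B \<union> C))" "u \<notin> B \<union> C" "B \<inter> C = {}"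
    "span B = S" "card B = dim S" "card C = DIM('a) - dim S - 1"
    "\<mu> - orth_proj S \<mu> = c *\<^sub>R u"
proof -
  obtain B where B: "pairwise orthogonal B" "\<And>x. x \<in> B \<Longrightarrow> norm x = 1" "card B = dim S" "span B = S"
    using S by (rule orthonormal_basis_subspace) blast
  have "S \<noteq> UNIV" using dim by auto
  then obtain x where x: "x \<notin> S" by auto
  define d where "d = \<mu> - orth_proj S \<mu>"
  \<comment> \<open>without bias any direction orthogonal to \<open>S\<close> serves as \<open>u\<close>\<close>
  define w where "w = (if d = 0 then x - orth_proj S x else d)"
  have w0: "w \<noteq> 0" using x orth_proj_in[OF S, of x] by (auto simp: w_def)
  have w_orth: "w \<bullet> v = 0" if "v \<in> S" for v
    using orth_proj_orthogonal[OF S that] by (simp add: w_def d_def)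
  define u where "u = w /\<^sub>R norm w"
  have u1: "norm u = 1" using w0 by (simp add: u_def)
  have u_orth: "u \<bullet> v = 0" if "v \<in> S" for v using w_orth[OF that] by (simp add: u_def)
  have du: "d = (if d = 0 then 0 else norm w) *\<^sub>R u" using w0 by (simp add: u_def w_def)
  have BS: "b \<in> S" if "b \<in> B" for b using that B(4) by (metis span_base)
  have uB: "u \<notin> B"
  proof
    assume "u \<in> B"
    then have "u \<bullet> u = 0" using BS u_orth by blast
    then show False using u1 by auto
  qed
  have on1: "orthonormal (insert u B)"
    using B u1 u_orth BS
    by (auto simp: orthonormal_def pairwise_insert orthogonal_def inner_commute)
  define S2 where "S2 = {y \<in> UNIV. \<forall>x \<in> span (insert u B). orthogonal x y}"
  have S2: "subspace S2"
    unfolding S2_def by (auto simp: subspace_def orthogonal_def inner_add_right)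
  have fin: "finite B" using orthonormal_finite[OF on1] by simp
  have "dim S2 + dim (span (insert u B)) = dim (UNIV :: 'a set)"
    unfolding S2_def by (rule dim_subspace_orthogonal_to_vectors) (auto simp: subspace_span)
  moreover have "dim (span (insert u B)) = dim S + 1"
    using orthonormal_independent[OF on1] fin uB B(3) by (simp add: dim_span dim_eq_card_independent)
  ultimately have dimS2: "dim S2 = DIM('a) - dim S - 1" by simp
  obtain C where C: "C \<subseteq> S2" "pairwise orthogonal C" "\<And>x. x \<in> C \<Longrightarrow> norm x = 1" "card C = dim S2"
    using S2 by (rule orthonormal_basis_subspace) blast
  have C_orth: "b \<bullet> v = 0" if "b \<in> insert u B" "v \<in> C" for b v
    using that C(1) span_base[of b "insert u B"] by (auto simp: S2_def orthogonal_def)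
  have disj: "insert u B \<inter> C = {}"
  proof -
    have False if "b \<in> insert u B" "b \<in> C" for b
      using C_orth[OF that] C(3)[OF that(2)] by auto
    then show ?thesis by blast
  qed
  have "orthonormal (insert u B \<union> C)"
    using on1 C C_orth unfolding orthonormal_def pairwise_def orthogonal_def
    by (metis Un_iff inner_commute)
  then have "orthonormal (insert u (B \<union> C))" by simp
  then show ?thesis
    using that[of u B C "if d = 0 then 0 else norm w"] uB disj B C dimS2 du
    unfolding d_def by auto
qed

text \<open>
  Absorbs the cross term \<open>2 * w\<close> between bias and noise into the squared bias \<open>\<delta>\<close> and the squared
  noise component \<open>s\<close>.
\<close>

lemma weighted_AM_GM_nonneg:
  fixes \<delta> s w K :: real
  assumes "0 \<le> \<delta>" "0 \<le> s" "0 < K" "w\<^sup>2 \<le> \<delta> * s"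
  shows "0 \<le> \<delta> / K + 2 * w + K * s"
proof -
  have "\<bar>w\<bar> \<le> sqrt (\<delta> / K * (K * s))"
    using assms by (intro real_le_rsqrt) auto
  also have "\<dots> \<le> (\<delta> / K + K * s) / 2"
    using assms by (intro arith_geo_mean_sqrt) auto
  finally show ?thesis by (auto simp: abs_le_iff)
qed

lemma residual_norm:
  fixes S :: "'a::euclidean_space set"
  assumes S: "subspace S" and y: "y = \<mu> + \<sigma> *\<^sub>R z"
  shows "(norm (y - orth_proj S y))\<^sup>2 =
      (norm (\<mu> - orth_proj S \<mu>))\<^sup>2 + 2 * \<sigma> * ((\<mu> - orth_proj S \<mu>) \<bullet> z) +
      \<sigma>\<^sup>2 * ((norm z)\<^sup>2 - (norm (orth_proj S z))\<^sup>2)"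
    and estimation_error: "(norm (\<mu> - orth_proj S y))\<^sup>2 =
      (norm (\<mu> - orth_proj S \<mu>))\<^sup>2 + \<sigma>\<^sup>2 * (norm (orth_proj S z))\<^sup>2"
proof -
  let ?d = "\<mu> - orth_proj S \<mu>" and ?p = "orth_proj S z"
  have dp: "?d \<bullet> ?p = 0" and zp: "(z - ?p) \<bullet> ?p = 0"
    using S by (auto intro: orth_proj_orthogonal orth_proj_in)
  have 1: "y - orth_proj S y = ?d + \<sigma> *\<^sub>R (z - ?p)" and 2: "\<mu> - orth_proj S y = ?d - \<sigma> *\<^sub>R ?p"
    using y by (simp_all add: orth_proj_affine[OF S] algebra_simps)
  have "z \<bullet> ?p = ?p \<bullet> ?p" using zp by (simp add: inner_diff_left)
  then have zz: "(z - ?p) \<bullet> (z - ?p) = z \<bullet> z - ?p \<bullet> ?p"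
    by (simp add: inner_diff_left inner_diff_right inner_commute)
  have "(norm (y - orth_proj S y))\<^sup>2 = ?d \<bullet> ?d + 2 * \<sigma> * (?d \<bullet> (z - ?p)) + \<sigma>\<^sup>2 * ((z - ?p) \<bullet> (z - ?p))"
    unfolding 1 power2_norm_eq_inner
    by (simp only: inner_add_left inner_add_right inner_scaleR_left inner_scaleR_right inner_commute[of "z - ?p" ?d] power2_eq_square)
      (simp add: algebra_simps)
  also have "?d \<bullet> (z - ?p) = ?d \<bullet> z" using dp by (simp add: inner_diff_right)
  finally show "(norm (y - orth_proj S y))\<^sup>2 =
      (norm ?d)\<^sup>2 + 2 * \<sigma> * (?d \<bullet> z) + \<sigma>\<^sup>2 * ((norm z)\<^sup>2 - (norm ?p)\<^sup>2)"
    by (simp add: zz power2_norm_eq_inner)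
  show "(norm (\<mu> - orth_proj S y))\<^sup>2 = (norm ?d)\<^sup>2 + \<sigma>\<^sup>2 * (norm ?p)\<^sup>2"
    unfolding 2 power2_norm_eq_inner using dp
    by (simp only: inner_diff_left[of ?d "\<sigma> *\<^sub>R ?p"] inner_diff_right[of _ ?d "\<sigma> *\<^sub>R ?p"] inner_scaleR_left inner_scaleR_right inner_commute[of ?p ?d] power2_eq_square)
      simp
qed

text \<open>
  In units of \<open>\<sigma>\<^sup>2\<close>, with squared bias \<open>\<delta>\<close>, squared noise components \<open>p\<close> along \<open>S\<close> and \<open>s\<close> along
  \<open>u\<close>, and cross term \<open>w\<close>, the loss is \<open>\<delta> + p\<close> and the residual is \<open>\<delta> + 2 * w + (norm z)\<^sup>2 - p\<close>. The
  difference of the two sides is then the sum of \<open>\<delta> / K + 2 * w + K * s\<close> and \<open>(K - 1)\<^sup>2 / K * p\<close>.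
\<close>

lemma pathwise_risk_bound:
  fixes S :: "'a::euclidean_space set"
  assumes S: "subspace S" and y: "y = \<mu> + \<sigma> *\<^sub>R z" and \<sigma>: "0 < \<sigma>" and K: "1 < K"
    and on: "orthonormal (insert u B)" and u: "u \<notin> B" and B: "span B = S"
    and d: "\<mu> - orth_proj S \<mu> = c *\<^sub>R u"
  shows "(K - 1) / K * ((norm (\<mu> - orth_proj S y))\<^sup>2 / \<sigma>\<^sup>2) \<le>
    (norm (y - orth_proj S y))\<^sup>2 / \<sigma>\<^sup>2 - (norm z)\<^sup>2 + K * (\<Sum>b\<in>insert u B. (z \<bullet> b)\<^sup>2)"
proof -
  have onB: "orthonormal B" using on by (auto simp: orthonormal_def pairwise_insert)
  define p where "p = (norm (orth_proj S z))\<^sup>2"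
  define s where "s = (z \<bullet> u)\<^sup>2"
  define \<delta> where "\<delta> = c\<^sup>2 / \<sigma>\<^sup>2"
  define w where "w = c * (z \<bullet> u) / \<sigma>"
  have u1: "norm u = 1" using on by (simp add: orthonormal_def)
  have U: "(\<Sum>b\<in>insert u B. (z \<bullet> b)\<^sup>2) = s + p"
    using orthonormal_finite[OF onB] u norm_orth_proj_orthonormal[OF onB B] by (simp add: s_def p_def)
  have nd: "(norm (\<mu> - orth_proj S \<mu>))\<^sup>2 = \<delta> * \<sigma>\<^sup>2"
    using u1 \<sigma> by (simp add: d \<delta>_def power_mult_distrib)
  have dz: "(\<mu> - orth_proj S \<mu>) \<bullet> z = \<sigma> * w"
    using \<sigma> by (simp add: d w_def inner_commute)
  have res: "(norm (y - orth_proj S y))\<^sup>2 / \<sigma>\<^sup>2 = \<delta> + 2 * w + (norm z)\<^sup>2 - p"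
    unfolding residual_norm[OF S y] nd dz p_def using \<sigma> by (simp add: field_simps power2_eq_square)
  have err: "(norm (\<mu> - orth_proj S y))\<^sup>2 / \<sigma>\<^sup>2 = \<delta> + p"
    unfolding estimation_error[OF S y] nd p_def using \<sigma> by (simp add: field_simps)
  have "0 \<le> \<delta> / K + 2 * w + K * s"
    using K by (intro weighted_AM_GM_nonneg) (auto simp: \<delta>_def s_def w_def power_divide power_mult_distrib)
  moreover have "0 \<le> (K - 1)\<^sup>2 / K * p" using K by (simp add: p_def)
  moreover have "(K - 1)\<^sup>2 / K * p = K * p - 2 * p + p / K"
      "(K - 1) / K * (\<delta> + p) = \<delta> + p - \<delta> / K - p / K" "K * (s + p) = K * s + K * p"
    using K by (simp_all add: power2_eq_square field_simps)
  ultimately show ?thesis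
    unfolding res err U by linarith
qed

text \<open>
  Neither \<open>\<mu>\<close> nor the fitted value has a component along \<open>C\<close>, so the residual has the coordinates of
  the pure noise there, and Bessel's inequality applies.
\<close>

lemma residual_lower_bound:
  fixes S :: "'a::euclidean_space set"
  assumes S: "subspace S" and y: "y = \<mu> + \<sigma> *\<^sub>R z"
    and on: "orthonormal (insert u (B \<union> C))" and disj: "u \<notin> B \<union> C" "B \<inter> C = {}"
    and B: "span B = S" and d: "\<mu> - orth_proj S \<mu> = c *\<^sub>R u"
  shows "\<sigma>\<^sup>2 * (\<Sum>b\<in>C. (z \<bullet> b)\<^sup>2) \<le> (norm (y - orth_proj S y))\<^sup>2"
proof -
  have onC: "orthonormal C" using on by (auto simp: orthonormal_def pairwise_insert pairwise_def)
  have eq: "(y - orth_proj S y) \<bullet> b = \<sigma> * (z \<bullet> b)" if b: "b \<in> C" for b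
  proof -
    have "v \<bullet> b = 0" if "v \<in> S" for v
    proof -
      have "orthogonal b v"
        using that unfolding B[symmetric]
      proof (rule orthogonal_to_span)
        fix a assume "a \<in> B"
        then show "orthogonal b a"
          using orthonormal_inner[OF on, of b a] b disj by (auto simp: orthogonal_def)
      qed
      then show ?thesis by (simp add: orthogonal_def inner_commute)
    qed
    then have pb: "orth_proj S x \<bullet> b = 0" for x using S by (auto intro: orth_proj_in)
    have "(\<mu> - orth_proj S \<mu>) \<bullet> b = 0"
      using orthonormal_inner[OF on, of u b] b disj by (auto simp: d)
    then have "\<mu> \<bullet> b = 0" by (simp add: inner_diff_left pb)
    then show ?thesis using y by (simp add: inner_diff_left inner_add_left pb)
  qed
  have "\<sigma>\<^sup>2 * (\<Sum>b\<in>C. (z \<bullet> b)\<^sup>2) = (\<Sum>b\<in>C. ((y - orth_proj S y) \<bullet> b)\<^sup>2)"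
    by (simp add: eq sum_distrib_left power_mult_distrib)
  also have "\<dots> = (norm (orth_proj (span C) (y - orth_proj S y)))\<^sup>2"
    by (rule norm_orth_proj_orthonormal[OF onC refl, symmetric])
  also have "\<dots> \<le> (norm (y - orth_proj S y))\<^sup>2"
    by (intro power_mono norm_orth_proj_le subspace_span) simp
  finally show ?thesis .
qed

section \<open>Countable families of random variables\<close>

lemma nn_integral_count_space_eq_infsum:
  fixes f :: "'a \<Rightarrow> real"
  assumes "f summable_on A" "\<And>x. x \<in> A \<Longrightarrow> 0 \<le> f x"
  shows "(\<integral>\<^sup>+x. ennreal (f x) \<partial>count_space A) = ennreal (infsum f A)"
proof -
  have "Infinite_Sum.abs_summable_on f A"
    using assms by (subst summable_on_iff_abs_summable_on_real[symmetric]) auto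
  then have abs: "Infinite_Set_Sum.abs_summable_on f A"
    using abs_summable_equivalent by blast
  then show ?thesis
    using assms(2) by (simp add: nn_integral_conv_infsetsum infsetsum_infsum)
qed

lemma borel_measurable_nn_integral_count_space:
  fixes f :: "'i \<Rightarrow> 'a \<Rightarrow> ennreal"
  assumes "countable I" and [measurable]: "\<And>i. i \<in> I \<Longrightarrow> f i \<in> borel_measurable M"
  shows "(\<lambda>x. \<integral>\<^sup>+i. f i x \<partial>count_space I) \<in> borel_measurable M"
proof (cases "finite I")
  case True
  then show ?thesis by (simp add: nn_integral_count_space_finite)
next
  case False
  then have [simp]: "I \<noteq> {}" by auto
  note * = bij_betw_from_nat_into[OF \<open>countable I\<close> False]
  have "(\<integral>\<^sup>+i. g i \<partial>count_space I) = (\<Sum>n. g (from_nat_into I n))" for g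
    by (simp add: nn_integral_bij_count_space[symmetric, OF *] nn_integral_count_space_nat)
  then show ?thesis by (simp add: from_nat_into)
qed

text \<open>
  The majorant is the sum of the family. It dominates the value at a random index without any
  measurability of that index.
\<close>

lemma (in prob_space) integrable_majorant_of_countable_family:
  fixes f :: "'m \<Rightarrow> 'a \<Rightarrow> real"
  assumes I: "countable I" and f: "\<And>m. m \<in> I \<Longrightarrow> integrable M (f m)" "\<And>m \<omega>. m \<in> I \<Longrightarrow> 0 \<le> f m \<omega>"
    and s: "(\<lambda>m. expectation (f m)) summable_on I"
  obtains G where "integrable M G" "expectation G = (\<Sum>\<^sub>\<infinity>m\<in>I. expectation (f m))"
    "AE \<omega> in M. \<forall>m\<in>I. f m \<omega> \<le> G \<omega>"
proof -
  let ?s = "\<Sum>\<^sub>\<infinity>m\<in>I. expectation (f m)"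
  define H where "H \<omega> = (\<integral>\<^sup>+m. ennreal (f m \<omega>) \<partial>count_space I)" for \<omega>
  have f_meas: "\<And>m. m \<in> I \<Longrightarrow> (\<lambda>\<omega>. ennreal (f m \<omega>)) \<in> borel_measurable M"
    using f(1) by auto
  have s_nonneg: "0 \<le> ?s"
    using f(2) by (intro infsum_nonneg integral_nonneg_AE) auto
  have H_int: "(\<integral>\<^sup>+\<omega>. H \<omega> \<partial>M) = ennreal ?s"
  proof -
    have "(\<integral>\<^sup>+\<omega>. H \<omega> \<partial>M) = (\<integral>\<^sup>+m. \<integral>\<^sup>+\<omega>. ennreal (f m \<omega>) \<partial>M \<partial>count_space I)"
      unfolding H_def by (rule nn_integral_count_space_nn_integral[OF I f_meas])
    also have "\<dots> = (\<integral>\<^sup>+m. ennreal (expectation (f m)) \<partial>count_space I)"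
      using f by (intro nn_integral_cong nn_integral_eq_integral) auto
    also have "\<dots> = ennreal ?s"
      using f(2) by (intro nn_integral_count_space_eq_infsum s integral_nonneg_AE) auto
    finally show ?thesis .
  qed
  have H_meas[measurable]: "H \<in> borel_measurable M"
    unfolding H_def using I f_meas by (intro borel_measurable_nn_integral_count_space) auto
  have fin: "AE \<omega> in M. H \<omega> \<noteq> \<infinity>"
    using H_int by (intro nn_integral_noteq_infinite) auto
  have eq: "(\<integral>\<^sup>+\<omega>. ennreal (enn2real (H \<omega>)) \<partial>M) = ennreal ?s"
    unfolding H_int[symmetric] using fin by (intro nn_integral_cong_AE) (auto elim!: eventually_mono simp: less_top)
  have bound: "AE \<omega> in M. \<forall>m\<in>I. f m \<omega> \<le> enn2real (H \<omega>)"
    using fin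
  proof eventually_elim
    case (elim \<omega>)
    show ?case
    proof
      fix m assume m: "m \<in> I"
      have "ennreal (f m \<omega>) = (\<integral>\<^sup>+n. ennreal (f m \<omega>) * indicator {m} n \<partial>count_space I)"
        using m by (subst nn_integral_cmult_indicator) auto
      also have "\<dots> \<le> H \<omega>"
        unfolding H_def by (intro nn_integral_mono) (auto simp: indicator_def)
      finally have "ennreal (f m \<omega>) \<le> ennreal (enn2real (H \<omega>))"
        using elim by (simp add: less_top)
      then show "f m \<omega> \<le> enn2real (H \<omega>)" by (simp add: ennreal_le_iff)
    qed
  qed
  have "integrable M (\<lambda>\<omega>. enn2real (H \<omega>)) \<and> expectation (\<lambda>\<omega>. enn2real (H \<omega>)) = ?s"
    using nn_integral_eq_integrable[of "\<lambda>\<omega>. enn2real (H \<omega>)" M ?s] eq s_nonneg by simp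
  then show ?thesis
    using bound by (intro that[of "\<lambda>\<omega>. enn2real (H \<omega>)"]) auto
qed

text \<open>
  The first Borel-Cantelli lemma for an arbitrary countable index set: the expected number of events
  that occur is finite.
\<close>

lemma (in prob_space) AE_finitely_many:
  assumes I: "countable I" and A: "\<And>m. m \<in> I \<Longrightarrow> A m \<in> events"
    and s: "(\<lambda>m. prob (A m)) summable_on I"
  shows "AE \<omega> in M. finite {m \<in> I. \<omega> \<in> A m}"
proof -
  define H :: "'a \<Rightarrow> ennreal" where "H \<omega> = (\<integral>\<^sup>+m. indicator (A m) \<omega> \<partial>count_space I)" for \<omega>
  have meas: "\<And>m. m \<in> I \<Longrightarrow> (\<lambda>\<omega>. indicator (A m) \<omega> :: ennreal) \<in> borel_measurable M"
    using A by auto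
  have "(\<integral>\<^sup>+\<omega>. H \<omega> \<partial>M) = (\<integral>\<^sup>+m. \<integral>\<^sup>+\<omega>. indicator (A m) \<omega> \<partial>M \<partial>count_space I)"
    unfolding H_def by (rule nn_integral_count_space_nn_integral[OF I meas])
  also have "\<dots> = (\<integral>\<^sup>+m. ennreal (prob (A m)) \<partial>count_space I)"
    using A by (intro nn_integral_cong) (simp add: emeasure_eq_measure)
  also have "\<dots> = ennreal (\<Sum>\<^sub>\<infinity>m\<in>I. prob (A m))"
    by (intro nn_integral_count_space_eq_infsum s) simp
  finally have "(\<integral>\<^sup>+\<omega>. H \<omega> \<partial>M) \<noteq> \<infinity>" by simp
  moreover have "H \<in> borel_measurable M"
    unfolding H_def using I meas by (intro borel_measurable_nn_integral_count_space) auto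
  ultimately have "AE \<omega> in M. H \<omega> \<noteq> \<infinity>" by (intro nn_integral_noteq_infinite)
  then show ?thesis
  proof eventually_elim
    case (elim \<omega>)
    have "H \<omega> = (\<integral>\<^sup>+m. indicator {m \<in> I. \<omega> \<in> A m} m \<partial>count_space I)"
      unfolding H_def by (intro nn_integral_cong) (auto simp: indicator_def)
    also have "\<dots> = emeasure (count_space I) {m \<in> I. \<omega> \<in> A m}"
      by (intro nn_integral_indicator) auto
    finally have H: "H \<omega> = emeasure (count_space I) {m \<in> I. \<omega> \<in> A m}" .
    show ?case
    proof (rule ccontr)
      assume "infinite {m \<in> I. \<omega> \<in> A m}"
      then have "H \<omega> = \<infinity>"
        unfolding H by (intro emeasure_count_space_infinite) auto
      with elim show False by simp
    qed
  qed
qed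

lemma minimizer_exists_of_finite_sublevels:
  assumes "A \<noteq> {}" and fin: "\<And>C. finite {m \<in> A. f m \<le> C}"
  shows "\<exists>m. minimizes_over A f m"
proof -
  obtain m0 where m0: "m0 \<in> A" using assms by auto
  let ?F = "{m \<in> A. f m \<le> f m0}"
  obtain m where "is_arg_min f (\<lambda>m. m \<in> ?F) m"
    using ex_is_arg_min_if_finite[OF fin[of "f m0"], of f] m0 by auto
  then have m: "m \<in> ?F" "\<And>n. n \<in> ?F \<Longrightarrow> f m \<le> f n"
    by (auto simp: is_arg_min_linorder)
  have "f m \<le> f n" if "n \<in> A" for n
    using m that by (cases "f n \<le> f m0") auto
  then show ?thesis using m by (auto simp: minimizes_over_def)
qed


section \<open>Statistics of a single model\<close>

text \<open>
  Everything that the argument needs to know about one model: the \<open>\<chi>\<^sup>2\<close> pair built on the adapted basis,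
  its two pathwise roles, and the mean residual sum of squares.
\<close>

lemma (in prob_space) model_statistics:
  fixes E Y :: "'a \<Rightarrow> 'b::euclidean_space" and S :: "'b set"
  assumes E_meas[measurable]: "E \<in> borel_measurable M"
    and E: "iid_std_normal M (\<lambda>b \<omega>. E \<omega> \<bullet> b) Basis"
    and Y: "\<And>\<omega>. Y \<omega> = \<mu> + \<sigma> *\<^sub>R E \<omega>" and \<sigma>: "0 < \<sigma>" and K: "1 < K"
    and S: "subspace S" and dim: "dim S + 2 \<le> DIM('b)"
  obtains U V where "U \<in> borel_measurable M" "V \<in> borel_measurable M"
    "distr M (borel \<Otimes>\<^sub>M borel) (\<lambda>\<omega>. (U \<omega>, V \<omega>)) = chi_square_pair (dim S + 1) (DIM('b) - dim S - 1)"
    "\<And>\<omega>. \<sigma>\<^sup>2 * V \<omega> \<le> (norm (Y \<omega> - orth_proj S (Y \<omega>)))\<^sup>2"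
    "\<And>\<omega>. (K - 1) / K * ((norm (\<mu> - orth_proj S (Y \<omega>)))\<^sup>2 / \<sigma>\<^sup>2) \<le>
      (norm (Y \<omega> - orth_proj S (Y \<omega>)))\<^sup>2 / \<sigma>\<^sup>2 - (norm (E \<omega>))\<^sup>2 + K * U \<omega>"
    "integrable M (\<lambda>\<omega>. (norm (Y \<omega> - orth_proj S (Y \<omega>)))\<^sup>2)"
    "expectation (\<lambda>\<omega>. (norm (Y \<omega> - orth_proj S (Y \<omega>)))\<^sup>2) =
      (norm (\<mu> - orth_proj S \<mu>))\<^sup>2 + \<sigma>\<^sup>2 * real (DIM('b) - dim S)"
proof -
  obtain B u C c where on: "orthonormal (insert u (B \<union> C))" and disj: "u \<notin> B \<union> C" "B \<inter> C = {}"
    and B: "span B = S" "card B = dim S" and C: "card C = DIM('b) - dim S - 1"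
    and d: "\<mu> - orth_proj S \<mu> = c *\<^sub>R u"
    by (rule adapted_orthonormal_basis[OF S, of \<mu>]) (use dim in auto)
  define U where "U \<omega> = (\<Sum>b\<in>insert u B. (E \<omega> \<bullet> b)\<^sup>2)" for \<omega>
  define V where "V \<omega> = (\<Sum>b\<in>C. (E \<omega> \<bullet> b)\<^sup>2)" for \<omega>
  have fin: "finite B" "finite C" using orthonormal_finite[OF on] by auto
  have onuB: "orthonormal (insert u B)" and onB: "orthonormal B"
    using on by (auto simp: orthonormal_def pairwise_insert pairwise_def)
  have card: "card (insert u (B \<union> C)) = DIM('b)"
    using fin disj B(2) C dim by (simp add: card_Un_disjoint)
  have iid: "iid_std_normal M (\<lambda>b \<omega>. E \<omega> \<bullet> b) (insert u (B \<union> C))"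
    using on card by (rule iid_std_normal_orthonormal[OF E_meas E])
  have "distr M (borel \<Otimes>\<^sub>M borel) (\<lambda>\<omega>. (U \<omega>, V \<omega>)) = chi_square_pair (card (insert u B)) (card C)"
    unfolding U_def V_def using iid fin disj C dim
    by (intro chi_square_pair_distr) auto
  then have law: "distr M (borel \<Otimes>\<^sub>M borel) (\<lambda>\<omega>. (U \<omega>, V \<omega>)) = chi_square_pair (dim S + 1) (DIM('b) - dim S - 1)"
    using fin disj B C by simp
  note moments = iid_std_normal_moments[OF iid] iid_std_normal_moments[OF E]
  have res: "(norm (Y \<omega> - orth_proj S (Y \<omega>)))\<^sup>2 = (norm (\<mu> - orth_proj S \<mu>))\<^sup>2 + 2 * \<sigma> * (c * (E \<omega> \<bullet> u)) +
      \<sigma>\<^sup>2 * ((\<Sum>b\<in>Basis. (E \<omega> \<bullet> b)\<^sup>2) - (\<Sum>b\<in>B. (E \<omega> \<bullet> b)\<^sup>2))" for \<omega>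
  proof -
    have "(norm (E \<omega>))\<^sup>2 = (\<Sum>b\<in>Basis. (E \<omega> \<bullet> b)\<^sup>2)"
      unfolding power2_norm_eq_inner by (subst euclidean_inner) (simp add: power2_eq_square)
    then show ?thesis
      unfolding residual_norm[OF S Y] norm_orth_proj_orthonormal[OF onB B(1)] d
      by (simp add: inner_commute)
  qed
  have int: "has_bochner_integral M (\<lambda>\<omega>. (norm (\<mu> - orth_proj S \<mu>))\<^sup>2 + 2 * \<sigma> * (c * (E \<omega> \<bullet> u)) +
      \<sigma>\<^sup>2 * ((\<Sum>b\<in>Basis. (E \<omega> \<bullet> b)\<^sup>2) - (\<Sum>b\<in>B. (E \<omega> \<bullet> b)\<^sup>2)))
      ((norm (\<mu> - orth_proj S \<mu>))\<^sup>2 + 2 * \<sigma> * (c * 0) + \<sigma>\<^sup>2 * ((\<Sum>b\<in>(Basis :: 'b set). 1) - (\<Sum>b\<in>B. 1)))"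
    using moments
    by (intro has_bochner_integral_add has_bochner_integral_mult_right has_bochner_integral_diff has_bochner_integral_sum)
      (auto simp: has_bochner_integral_iff prob_space)
  show ?thesis
  proof (rule that[of U V])
    show "U \<in> borel_measurable M" "V \<in> borel_measurable M"
      unfolding U_def V_def by measurable
    show "\<sigma>\<^sup>2 * V \<omega> \<le> (norm (Y \<omega> - orth_proj S (Y \<omega>)))\<^sup>2" for \<omega>
      unfolding V_def by (rule residual_lower_bound[OF S Y on disj B(1) d])
    show "(K - 1) / K * ((norm (\<mu> - orth_proj S (Y \<omega>)))\<^sup>2 / \<sigma>\<^sup>2) \<le>
      (norm (Y \<omega> - orth_proj S (Y \<omega>)))\<^sup>2 / \<sigma>\<^sup>2 - (norm (E \<omega>))\<^sup>2 + K * U \<omega>" for \<omega>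
      unfolding U_def using disj by (intro pathwise_risk_bound[OF S Y \<sigma> K onuB _ B(1) d]) auto
    show "integrable M (\<lambda>\<omega>. (norm (Y \<omega> - orth_proj S (Y \<omega>)))\<^sup>2)"
      using int unfolding res[symmetric] by (auto simp: has_bochner_integral_iff)
    show "expectation (\<lambda>\<omega>. (norm (Y \<omega> - orth_proj S (Y \<omega>)))\<^sup>2) =
      (norm (\<mu> - orth_proj S \<mu>))\<^sup>2 + \<sigma>\<^sup>2 * real (DIM('b) - dim S)"
      using int B dim unfolding res[symmetric] by (auto simp: has_bochner_integral_iff of_nat_diff)
  qed (rule law)
qed

lemma (in prob_space) expectation_excess:
  assumes [measurable]: "U \<in> borel_measurable M" "V \<in> borel_measurable M"
    and law: "distr M (borel \<Otimes>\<^sub>M borel) (\<lambda>\<omega>. (U \<omega>, V \<omega>)) = chi_square_pair D N"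
  shows "integrable M (\<lambda>\<omega>. max (U \<omega> - x * (V \<omega> / real N)) 0)"
    "expectation (\<lambda>\<omega>. max (U \<omega> - x * (V \<omega> / real N)) 0) = excess D N x"
proof -
  let ?g = "\<lambda>z::real \<times> real. max (fst z - x * (snd z / real N)) 0"
  have meas: "(\<lambda>\<omega>. (U \<omega>, V \<omega>)) \<in> M \<rightarrow>\<^sub>M borel \<Otimes>\<^sub>M borel" "?g \<in> borel_measurable (borel \<Otimes>\<^sub>M borel)"
    by measurable
  show "integrable M (\<lambda>\<omega>. max (U \<omega> - x * (V \<omega> / real N)) 0)"
    using integrable_excess[of D N x] unfolding law[symmetric] integrable_distr_eq[OF meas] by simp
  show "expectation (\<lambda>\<omega>. max (U \<omega> - x * (V \<omega> / real N)) 0) = excess D N x"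
    unfolding excess_eq law[symmetric] integral_distr[OF meas] by simp
qed

text \<open>
  The tail bound in a form that is summable over the models as soon as the mean excesses are, because
  the denominator depends on \<open>k\<close> only.
\<close>

lemma (in prob_space) prob_small_chi_square_bound:
  assumes [measurable]: "U \<in> borel_measurable M" "V \<in> borel_measurable M"
    and law: "distr M (borel \<Otimes>\<^sub>M borel) (\<lambda>\<omega>. (U \<omega>, V \<omega>)) = chi_square_pair D N"
    and D: "0 < D" and x: "0 \<le> x" and k: "0 < k"
  shows "prob {\<omega> \<in> space M. x * (V \<omega> / real N) \<le> k} \<le>
    excess D N x / (k * measure (density lborel std_normal_density) {z. 2 * k \<le> z\<^sup>2})"
proof -
  have "chi_square N = distr (chi_square_pair D N) borel snd"
    by (subst chi_square_pair_snd[symmetric, of _ D]) (rule distr_cong, auto)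
  also have "\<dots> = distr M borel V"
    unfolding law[symmetric] by (subst distr_distr) (auto simp: comp_def)
  finally have "measure (chi_square N) {v. x * (v / real N) \<le> k} = prob {\<omega> \<in> space M. x * (V \<omega> / real N) \<le> k}"
    by (simp add: measure_distr) (auto intro!: arg_cong2[where f=measure])
  moreover have "0 < k * measure (density lborel std_normal_density) {z. 2 * k \<le> z\<^sup>2}"
    using k measure_std_normal_tail_pos[of "2 * k"] by simp
  ultimately show ?thesis
    using excess_tail_bound[OF D x, of k N] k by (simp add: pos_le_divide_eq)
qed

lemma (in prob_space) iid_std_normal_vec:
  fixes \<epsilon> :: "'n::finite \<Rightarrow> 'a \<Rightarrow> real"
  assumes "indep_vars (\<lambda>_. borel) \<epsilon> UNIV" "\<And>i. distributed M lborel (\<epsilon> i) std_normal_density"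
  shows "(\<lambda>\<omega>. \<chi> i. \<epsilon> i \<omega>) \<in> borel_measurable M"
    and "iid_std_normal M (\<lambda>b \<omega>. (\<chi> i. \<epsilon> i \<omega>) \<bullet> b) (Basis :: (real ^ 'n) set)"
proof -
  have \<epsilon>: "iid_std_normal M \<epsilon> UNIV"
    using assms by (simp add: iid_std_normal_def)
  have coord: "(\<chi> i. \<epsilon> i \<omega>) \<bullet> b = \<epsilon> (axis_index b) \<omega>" if b: "b \<in> (Basis :: (real ^ 'n) set)" for b \<omega>
    using axis_index[OF b] by (metis cart_eq_inner_axis vec_lambda_beta)
  have inj: "inj_on axis_index (Basis :: (real ^ 'n) set)"
    by (rule inj_onI) (metis axis_index)
  have "iid_std_normal M (\<lambda>b. \<epsilon> (axis_index b)) (Basis :: (real ^ 'n) set)"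
    by (rule iid_std_normal_reindex[OF \<epsilon> _ _ inj]) auto
  then show "iid_std_normal M (\<lambda>b \<omega>. (\<chi> i. \<epsilon> i \<omega>) \<bullet> b) (Basis :: (real ^ 'n) set)"
    unfolding iid_std_normal_def by (simp add: coord cong: indep_vars_cong)
  have [measurable]: "\<epsilon> i \<in> borel_measurable M" for i
    using \<epsilon> by (rule iid_std_normal_measurable) simp
  show "(\<lambda>\<omega>. \<chi> i. \<epsilon> i \<omega>) \<in> borel_measurable M"
    by (subst borel_measurable_euclidean_space) (auto simp: coord)
qed

text \<open>
  The factors in the penalty are chosen so that the argument of \<open>Dkhi\<close> in \<open>Sigma_term\<close> is the value
  \<open>x\<close> of \<open>EDkhi\<close> itself, and the terms of the two series coincide.
\<close>

lemma pen_KL_calibration: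
  fixes S :: "'m \<Rightarrow> (real ^ 'n) set"
  assumes dim: "dim (S m) + 2 \<le> CARD('n)" and K: "1 < K" and L: "0 \<le> L m"
    and pen: "pen m = pen_KL K L S m"
  defines "x \<equiv> EDkhi (dim (S m) + 1) (codim (S m) - 1) (exp (- L m))"
  shows "0 \<le> x" "pen m / real (codim (S m)) = K * (x / real (codim (S m) - 1))"
    "Sigma_term K S pen m = excess (dim (S m) + 1) (codim (S m) - 1) x"
    "Sigma_term K S pen m = real (dim (S m) + 1) * exp (- L m)"
proof -
  let ?D = "dim (S m) + 1" and ?N = "codim (S m) - 1"
  have N: "0 < ?N" using dim by (simp add: codim_def)
  then have N': "0 < real (codim (S m))" "0 < real ?N" by auto
  show "0 \<le> x"
    unfolding x_def using N L by (intro EDkhi_inverse) auto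
  have D: "Dkhi ?D ?N x = exp (- L m)"
    unfolding x_def using N L by (intro EDkhi_inverse) auto
  show pen_x: "pen m / real (codim (S m)) = K * (x / real ?N)"
    unfolding pen pen_KL_def x_def using N' by simp
  have "real ?N / (K * real (codim (S m))) * pen m = x"
    using pen_x N' K by (simp add: field_simps del: of_nat_diff)
  then have Sigma: "Sigma_term K S pen m = real ?D * Dkhi ?D ?N x"
    by (simp add: Sigma_term_def)
  then show "Sigma_term K S pen m = real ?D * exp (- L m)"
    by (simp only: D)
  show "Sigma_term K S pen m = excess ?D ?N x"
    unfolding Sigma Dkhi_eq_excess by simp
qed

section \<open>Model selection\<close>

theorem proposition3:
  fixes P :: "'w measure"
    and \<epsilon> :: "'n::finite \<Rightarrow> 'w \<Rightarrow> real"
    and \<mu> :: "real ^ 'n"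
    and \<sigma> K :: real
    and Y :: "'w \<Rightarrow> real ^ 'n"
    and Ms :: "'m set"
    and S :: "'m \<Rightarrow> (real ^ 'n) set"
    and L pen :: "'m \<Rightarrow> real"
    and \<Sigma> \<Sigma>' :: real
  assumes prob: "prob_space P"
    and indep: "prob_space.indep_vars P (\<lambda>_. borel) \<epsilon> UNIV"
    and gauss: "\<And>i. distributed P lborel (\<epsilon> i) std_normal_density"
    and sigma_pos: "0 < \<sigma>"
    and Y: "\<And>\<omega>. Y \<omega> = (\<chi> i. \<mu> $ i + \<sigma> * \<epsilon> i \<omega>)"
    and Ms: "countable Ms" "Ms \<noteq> {}"
    and subsp: "\<And>m. m \<in> Ms \<Longrightarrow> subspace (S m)"
    and dim_le: "\<And>m. m \<in> Ms \<Longrightarrow> dim (S m) + 2 \<le> CARD('n)"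
    and K: "1 < K"
    and L_nonneg: "\<And>m. m \<in> Ms \<Longrightarrow> 0 \<le> L m"
    and L_summable: "(\<lambda>m. real (dim (S m) + 1) * exp (- L m)) summable_on Ms"
    and \<Sigma>': "\<Sigma>' = (\<Sum>\<^sub>\<infinity>m\<in>Ms. real (dim (S m) + 1) * exp (- L m))"
    and pen: "\<And>m. m \<in> Ms \<Longrightarrow> pen m = pen_KL K L S m"
    and \<Sigma>: "\<Sigma> = 2 * K\<^sup>2 / (K - 1) * (\<Sum>\<^sub>\<infinity>m\<in>Ms. Sigma_term K S pen m)"
  shows "(AE \<omega> in P. \<exists>m. minimizes_over Ms (Crit S pen (Y \<omega>)) m) \<and>
    Sigma_term K S pen summable_on Ms \<and>
    \<Sigma> \<le> 2 * K\<^sup>2 * \<Sigma>' / (K - 1) \<and>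
    (\<forall>mhat. (AE \<omega> in P. minimizes_over Ms (Crit S pen (Y \<omega>)) (mhat \<omega>)) \<longrightarrow>
       (\<lambda>\<omega>. orth_proj (S (mhat \<omega>)) (Y \<omega>)) \<in> borel_measurable P \<longrightarrow>
       integrable P (\<lambda>\<omega>. (norm (\<mu> - orth_proj (S (mhat \<omega>)) (Y \<omega>)))\<^sup>2 / \<sigma>\<^sup>2) \<and>
       (LINT \<omega>|P. (norm (\<mu> - orth_proj (S (mhat \<omega>)) (Y \<omega>)))\<^sup>2 / \<sigma>\<^sup>2)
         \<le> K / (K - 1) *
             (INF m\<in>Ms. (norm (\<mu> - orth_proj (S m) \<mu>))\<^sup>2 / \<sigma>\<^sup>2 * (1 + pen m / real (codim (S m)))
                + pen m - real (dim (S m)))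
           + \<Sigma>)"
proof -
  interpret P: prob_space P by (rule prob)
  define E :: "'w \<Rightarrow> real ^ 'n" where "E \<omega> = (\<chi> i. \<epsilon> i \<omega>)" for \<omega>
  have E_meas[measurable]: "E \<in> borel_measurable P"
    and E: "iid_std_normal P (\<lambda>b \<omega>. E \<omega> \<bullet> b) Basis"
    unfolding E_def using indep gauss by (rule P.iid_std_normal_vec)+
  have Y_E: "Y \<omega> = \<mu> + \<sigma> *\<^sub>R E \<omega>" for \<omega>
    by (simp add: Y E_def vec_eq_iff)
  define x where "x m = EDkhi (dim (S m) + 1) (codim (S m) - 1) (exp (- L m))" for m
  have x_nonneg: "0 \<le> x m"
    and pen_x: "pen m / real (codim (S m)) = K * (x m / real (codim (S m) - 1))"
    and Sigma_excess: "Sigma_term K S pen m = excess (dim (S m) + 1) (codim (S m) - 1) (x m)"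
    and Sigma_exp: "Sigma_term K S pen m = real (dim (S m) + 1) * exp (- L m)"
    if m: "m \<in> Ms" for m
    unfolding x_def by (rule pen_KL_calibration[where S=S and m=m and L=L and pen=pen, OF dim_le[OF m] K L_nonneg[OF m] pen[OF m]])+
  have codim_pos: "0 < real (codim (S m))" if "m \<in> Ms" for m
    using dim_le[OF that] by (simp add: codim_def)
  define R where "R m \<omega> = (norm (Y \<omega> - orth_proj (S m) (Y \<omega>)))\<^sup>2" for m \<omega>
  have Crit_R: "Crit S pen (Y \<omega>) m = R m \<omega> * (1 + pen m / real (codim (S m)))" for m \<omega>
    by (simp add: Crit_def R_def)

  define s where "s m = Sigma_term K S pen m" for m
  have s_eq: "s m = real (dim (S m) + 1) * exp (- L m)" if "m \<in> Ms" for m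
    unfolding s_def using that by (rule Sigma_exp)
  have s_nonneg: "0 \<le> s m" if "m \<in> Ms" for m using s_eq[OF that] by simp
  have s_summable: "s summable_on Ms"
    using L_summable s_eq by (subst summable_on_cong) auto
  have s_sum: "infsum s Ms = \<Sigma>'"
    unfolding \<Sigma>' using s_eq by (intro infsum_cong) auto
  have \<Sigma>_eq: "\<Sigma> = 2 * K\<^sup>2 / (K - 1) * infsum s Ms"
    unfolding \<Sigma> s_def ..

  define Q where "Q m U V \<longleftrightarrow> U \<in> borel_measurable P \<and> V \<in> borel_measurable P \<and>
    distr P (borel \<Otimes>\<^sub>M borel) (\<lambda>\<omega>. (U \<omega>, V \<omega>)) = chi_square_pair (dim (S m) + 1) (codim (S m) - 1) \<and>
    (\<forall>\<omega>. \<sigma>\<^sup>2 * V \<omega> \<le> R m \<omega>) \<and>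
    (\<forall>\<omega>. (K - 1) / K * ((norm (\<mu> - orth_proj (S m) (Y \<omega>)))\<^sup>2 / \<sigma>\<^sup>2) \<le>
      R m \<omega> / \<sigma>\<^sup>2 - (norm (E \<omega>))\<^sup>2 + K * U \<omega>) \<and>
    integrable P (R m) \<and>
    P.expectation (R m) = (norm (\<mu> - orth_proj (S m) \<mu>))\<^sup>2 + \<sigma>\<^sup>2 * real (codim (S m))" for m U V
  have "\<exists>U V. Q m U V" if m: "m \<in> Ms" for m
  proof -
    obtain U V where "Q m U V"
      by (rule P.model_statistics[OF E_meas E Y_E sigma_pos K subsp[OF m]])
        (use dim_le[OF m] in \<open>auto simp: Q_def R_def[abs_def] codim_def\<close>)
    then show ?thesis by blast
  qed
  then obtain U V where "\<And>m. m \<in> Ms \<Longrightarrow> Q m (U m) (V m)" by metis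
  then have U_meas[measurable]: "\<And>m. m \<in> Ms \<Longrightarrow> U m \<in> borel_measurable P"
    and V_meas[measurable]: "\<And>m. m \<in> Ms \<Longrightarrow> V m \<in> borel_measurable P"
    and law: "\<And>m. m \<in> Ms \<Longrightarrow> distr P (borel \<Otimes>\<^sub>M borel) (\<lambda>\<omega>. (U m \<omega>, V m \<omega>)) =
      chi_square_pair (dim (S m) + 1) (codim (S m) - 1)"
    and V_le: "\<And>m \<omega>. m \<in> Ms \<Longrightarrow> \<sigma>\<^sup>2 * V m \<omega> \<le> R m \<omega>"
    and risk_le: "\<And>m \<omega>. m \<in> Ms \<Longrightarrow> (K - 1) / K * ((norm (\<mu> - orth_proj (S m) (Y \<omega>)))\<^sup>2 / \<sigma>\<^sup>2) \<le>
      R m \<omega> / \<sigma>\<^sup>2 - (norm (E \<omega>))\<^sup>2 + K * U m \<omega>"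
    and R_int: "\<And>m. m \<in> Ms \<Longrightarrow> integrable P (R m)"
    and R_exp: "\<And>m. m \<in> Ms \<Longrightarrow> P.expectation (R m) =
      (norm (\<mu> - orth_proj (S m) \<mu>))\<^sup>2 + \<sigma>\<^sup>2 * real (codim (S m))"
    by (auto simp: Q_def)

  \<comment> \<open>the level that \<open>U m\<close> has to exceed in order to contribute to \<open>\<Sigma>\<close>; up to a constant factor also a lower bound for the criterion\<close>
  define T where "T m \<omega> = x m * (V m \<omega> / real (codim (S m) - 1))" for m \<omega>
  have pen_R: "\<sigma>\<^sup>2 * K * T m \<omega> \<le> R m \<omega> * (pen m / real (codim (S m)))" if m: "m \<in> Ms" for m \<omega>
  proof -
    have "\<sigma>\<^sup>2 * K * T m \<omega> = \<sigma>\<^sup>2 * V m \<omega> * (pen m / real (codim (S m)))"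
      unfolding pen_x[OF m] by (simp add: T_def)
    also have "\<dots> \<le> R m \<omega> * (pen m / real (codim (S m)))"
      unfolding pen_x[OF m] using V_le[OF m] x_nonneg[OF m] K by (intro mult_right_mono) auto
    finally show ?thesis .
  qed

  \<comment> \<open>\<open>Suc k\<close> rather than \<open>k\<close>, since the tail bound needs a positive level\<close>
  have "AE \<omega> in P. finite {m \<in> Ms. T m \<omega> \<le> real (Suc k)}" for k
  proof -
    let ?c = "real (Suc k)"
    let ?p = "?c * measure (density lborel std_normal_density) {z. 2 * ?c \<le> z\<^sup>2}"
    let ?A = "\<lambda>m. {\<omega> \<in> space P. T m \<omega> \<le> ?c}"
    have bound: "P.prob (?A m) \<le> s m / ?p" if m: "m \<in> Ms" for m
      unfolding T_def s_def Sigma_excess[OF m]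
      using m x_nonneg[OF m] by (intro P.prob_small_chi_square_bound[OF _ _ law]) auto
    have "(\<lambda>m. P.prob (?A m)) summable_on Ms"
    proof (rule summable_on_comparison_test)
      show "(\<lambda>m. s m / ?p) summable_on Ms"
        unfolding divide_inverse using s_summable by (rule summable_on_cmult_left)
    qed (use bound in auto)
    moreover have "?A m \<in> P.events" if "m \<in> Ms" for m
      unfolding T_def using that by measurable
    ultimately have "AE \<omega> in P. finite {m \<in> Ms. \<omega> \<in> ?A m}"
      using Ms by (intro P.AE_finitely_many) auto
    then show ?thesis
      using AE_space by eventually_elim simp
  qed
  then have "AE \<omega> in P. \<forall>k. finite {m \<in> Ms. T m \<omega> \<le> real (Suc k)}"
    by (simp add: AE_all_countable)
  then have existence: "AE \<omega> in P. \<exists>m. minimizes_over Ms (Crit S pen (Y \<omega>)) m"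
  proof eventually_elim
    case (elim \<omega>)
    show ?case
    proof (rule minimizer_exists_of_finite_sublevels[OF Ms(2)])
      fix C
      obtain k where k: "C / (\<sigma>\<^sup>2 * K) \<le> real k" using real_arch_simple by blast
      have "{m \<in> Ms. Crit S pen (Y \<omega>) m \<le> C} \<subseteq> {m \<in> Ms. T m \<omega> \<le> real (Suc k)}"
      proof safe
        fix m assume m: "m \<in> Ms" and C: "Crit S pen (Y \<omega>) m \<le> C"
        have "\<sigma>\<^sup>2 * K * T m \<omega> \<le> C"
          using pen_R[OF m, of \<omega>] C unfolding Crit_R by (simp add: distrib_left R_def) (smt (verit) zero_le_power2)
        then have "T m \<omega> \<le> C / (\<sigma>\<^sup>2 * K)"
          using sigma_pos K by (simp add: field_simps)
        then show "T m \<omega> \<le> real (Suc k)" using k by simp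
      qed
      then show "finite {m \<in> Ms. Crit S pen (Y \<omega>) m \<le> C}"
        using elim finite_subset by blast
    qed
  qed

  have exc: "integrable P (\<lambda>\<omega>. max (U m \<omega> - T m \<omega>) 0)" "P.expectation (\<lambda>\<omega>. max (U m \<omega> - T m \<omega>) 0) = s m"
    if m: "m \<in> Ms" for m
    unfolding T_def s_def Sigma_excess[OF m] using P.expectation_excess[OF U_meas[OF m] V_meas[OF m] law[OF m]] by auto
  have exc_summable: "(\<lambda>m. P.expectation (\<lambda>\<omega>. max (U m \<omega> - T m \<omega>) 0)) summable_on Ms"
    using s_summable exc(2) by (subst summable_on_cong) auto
  obtain G where G_int: "integrable P G"
    and "P.expectation G = (\<Sum>\<^sub>\<infinity>m\<in>Ms. P.expectation (\<lambda>\<omega>. max (U m \<omega> - T m \<omega>) 0))"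
    and G: "AE \<omega> in P. \<forall>m\<in>Ms. max (U m \<omega> - T m \<omega>) 0 \<le> G \<omega>"
    by (rule P.integrable_majorant_of_countable_family[OF Ms(1) exc(1) _ exc_summable]) auto
  then have G_exp: "P.expectation G = infsum s Ms"
    using exc(2) by (auto intro: infsum_cong)

  have E_norm: "integrable P (\<lambda>\<omega>. (norm (E \<omega>))\<^sup>2)" "P.expectation (\<lambda>\<omega>. (norm (E \<omega>))\<^sup>2) = real CARD('n)"
  proof -
    have eq: "(norm (E \<omega>))\<^sup>2 = (\<Sum>b\<in>Basis. (E \<omega> \<bullet> b)\<^sup>2)" for \<omega>
      unfolding power2_norm_eq_inner by (subst euclidean_inner) (simp add: power2_eq_square)
    show "integrable P (\<lambda>\<omega>. (norm (E \<omega>))\<^sup>2)" "P.expectation (\<lambda>\<omega>. (norm (E \<omega>))\<^sup>2) = real CARD('n)"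
      unfolding eq using P.iid_std_normal_moments(3,4)[OF E] by auto
  qed

  have risk: "integrable P (\<lambda>\<omega>. (norm (\<mu> - orth_proj (S (mhat \<omega>)) (Y \<omega>)))\<^sup>2 / \<sigma>\<^sup>2) \<and>
       (LINT \<omega>|P. (norm (\<mu> - orth_proj (S (mhat \<omega>)) (Y \<omega>)))\<^sup>2 / \<sigma>\<^sup>2)
         \<le> K / (K - 1) *
             (INF m\<in>Ms. (norm (\<mu> - orth_proj (S m) \<mu>))\<^sup>2 / \<sigma>\<^sup>2 * (1 + pen m / real (codim (S m)))
                + pen m - real (dim (S m)))
           + \<Sigma>"
    if mhat: "AE \<omega> in P. minimizes_over Ms (Crit S pen (Y \<omega>)) (mhat \<omega>)"
      and [measurable]: "(\<lambda>\<omega>. orth_proj (S (mhat \<omega>)) (Y \<omega>)) \<in> borel_measurable P"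
    for mhat
  proof -
    define W where "W \<omega> = (norm (\<mu> - orth_proj (S (mhat \<omega>)) (Y \<omega>)))\<^sup>2 / \<sigma>\<^sup>2" for \<omega>
    define r where "r m = (norm (\<mu> - orth_proj (S m) \<mu>))\<^sup>2 / \<sigma>\<^sup>2 * (1 + pen m / real (codim (S m)))
                + pen m - real (dim (S m))" for m
    define a where "a = (K - 1) / K"
    have a: "0 < a" using K by (simp add: a_def)
    have W_meas[measurable]: "W \<in> borel_measurable P" unfolding W_def by measurable
    have W_nonneg: "0 \<le> W \<omega>" for \<omega> by (simp add: W_def)
    \<comment> \<open>the upper bound for the loss obtained from comparing the selected model with the competitor \<open>m\<close>\<close>
    define H where "H m \<omega> = R m \<omega> * (1 + pen m / real (codim (S m))) / \<sigma>\<^sup>2 - (norm (E \<omega>))\<^sup>2 + K * G \<omega>" for m \<omega>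
    have H_int: "integrable P (H m)" if "m \<in> Ms" for m
      unfolding H_def using R_int[OF that] E_norm G_int by auto
    have H_exp: "P.expectation (H m) = r m + K * infsum s Ms" if m: "m \<in> Ms" for m
    proof -
      have "P.expectation (H m) = ((norm (\<mu> - orth_proj (S m) \<mu>))\<^sup>2 + \<sigma>\<^sup>2 * real (codim (S m))) *
          (1 + pen m / real (codim (S m))) / \<sigma>\<^sup>2 - real CARD('n) + K * infsum s Ms"
        unfolding H_def using R_int[OF m] E_norm G_int by (simp add: R_exp[OF m] G_exp)
      moreover have "real CARD('n) = real (codim (S m)) + real (dim (S m))"
        using dim_le[OF m] by (simp add: codim_def of_nat_diff)
      ultimately show ?thesis
        using codim_pos[OF m] sigma_pos by (simp add: r_def field_simps)
    qed
    have W_le: "AE \<omega> in P. a * W \<omega> \<le> H m \<omega>" if m: "m \<in> Ms" for m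
      using mhat G
    proof eventually_elim
      case (elim \<omega>)
      let ?h = "mhat \<omega>"
      have h: "?h \<in> Ms" and min: "Crit S pen (Y \<omega>) ?h \<le> Crit S pen (Y \<omega>) m"
        using elim(1) m by (auto simp: minimizes_over_def)
      \<comment> \<open>the criterion at the selected model exceeds its residual by at least the penalty credit \<open>\<sigma>\<^sup>2 * K * T\<close>\<close>
      have "R ?h \<omega> + \<sigma>\<^sup>2 * K * T ?h \<omega> \<le> Crit S pen (Y \<omega>) ?h"
        using pen_R[OF h] by (simp add: Crit_R distrib_left)
      also have "\<dots> \<le> R m \<omega> * (1 + pen m / real (codim (S m)))"
        using min by (simp only: Crit_R)
      finally have "(R ?h \<omega> + \<sigma>\<^sup>2 * K * T ?h \<omega>) / \<sigma>\<^sup>2 \<le> R m \<omega> * (1 + pen m / real (codim (S m))) / \<sigma>\<^sup>2"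
        by (rule divide_right_mono) simp
      moreover have "(R ?h \<omega> + \<sigma>\<^sup>2 * K * T ?h \<omega>) / \<sigma>\<^sup>2 = R ?h \<omega> / \<sigma>\<^sup>2 + K * T ?h \<omega>"
        using sigma_pos by (simp add: field_simps)
      moreover have "K * (U ?h \<omega> - T ?h \<omega>) \<le> K * G \<omega>"
        using elim(2) h K by (intro mult_left_mono) auto
      moreover have "a * W \<omega> \<le> R ?h \<omega> / \<sigma>\<^sup>2 - (norm (E \<omega>))\<^sup>2 + K * U ?h \<omega>"
        unfolding a_def W_def by (rule risk_le[OF h])
      ultimately show ?case
        unfolding H_def by (simp add: right_diff_distrib)
    qed
    obtain m0 where m0: "m0 \<in> Ms" using Ms(2) by auto
    have "integrable P (\<lambda>\<omega>. a * W \<omega>)"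
    proof (rule Bochner_Integration.integrable_bound[OF H_int[OF m0]])
      show "AE \<omega> in P. norm (a * W \<omega>) \<le> norm (H m0 \<omega>)"
        using W_le[OF m0]
      proof eventually_elim
        case (elim \<omega>)
        then show ?case using a W_nonneg[of \<omega>] by auto
      qed
    qed measurable
    then have W_int: "integrable P W" using a by simp
    have "a * P.expectation W - K * infsum s Ms \<le> r m" if m: "m \<in> Ms" for m
    proof -
      have "a * P.expectation W = P.expectation (\<lambda>\<omega>. a * W \<omega>)" by simp
      also have "\<dots> \<le> P.expectation (H m)"
        using W_int W_le[OF m] H_int[OF m] by (intro integral_mono_AE) auto
      finally show ?thesis by (simp add: H_exp[OF m])
    qed
    then have "a * P.expectation W - K * infsum s Ms \<le> (INF m\<in>Ms. r m)"
      using Ms(2) by (intro cINF_greatest)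
    then have "a * P.expectation W \<le> (INF m\<in>Ms. r m) + K * infsum s Ms" by simp
    then have "P.expectation W \<le> ((INF m\<in>Ms. r m) + K * infsum s Ms) / a"
      using a by (simp add: pos_le_divide_eq mult.commute)
    also have "\<dots> = K / (K - 1) * (INF m\<in>Ms. r m) + K\<^sup>2 / (K - 1) * infsum s Ms"
      using K by (simp add: a_def add_divide_distrib ring_distribs power2_eq_square mult_ac)
    also have "\<dots> \<le> K / (K - 1) * (INF m\<in>Ms. r m) + \<Sigma>"
    proof -
      have "0 \<le> K\<^sup>2 / (K - 1) * infsum s Ms"
        using K s_nonneg by (intro mult_nonneg_nonneg infsum_nonneg) auto
      then show ?thesis by (simp add: \<Sigma>_eq)
    qed
    finally show ?thesis
      using W_int unfolding W_def r_def by simp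
  qed
  show ?thesis
    using existence s_summable risk s_sum unfolding \<Sigma>_eq s_def[abs_def] by simp
qed

end
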